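(* Let $M^{m+1}$ be a Riemannian manifold and $p\in M^{m+1}$. On a sufficiently small neighborhood of $p$, a regular curve $\alpha:I\to M^{m+1}$ is normal with center $p$ if and only if it lies on a geodesic sphere with center $p$. That is, there is a neighborhood $W$ of $p$ such that for every regular curve $\alpha:I\to W\setminus\{p\}$: $\alpha$ is a normal curve with center $p$ if and only if $\alpha$ is contained in a geodesic sphere centered at $p$.
   Context: A regular curve $\alpha:I\to M^{m+1}$ is a normal curve with center $p$ if the (radial) geodesics $\beta_s$ connecting $p$ to $\alpha(s)$ are orthogonal to $\alpha$, i.e. $\langle\mathbf t_\alpha,\mathbf t_\beta\rangle=0$ along $\alpha$, where $\mathbf t_\alpha=\alpha'$ and $\mathbf t_\beta$ is the velocity of $\beta_s$ at $\alpha(s)$. Within a normal neighborhood of $p$ the connecting geodesic is the unique radial one. The geodesic sphere of radius $\delta$ centered at $p$ (with $\delta$ smaller than the injectivity radius) is $\exp_p(\{v\in T_pM:\Vert v\Vert=\delta\})$. *)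

theory Defs
  imports "HOL-Analysis.Analysis"
begin

section \<open>Smooth maps between normed spaces\<close>

text \<open>
  Derivatives are taken within the domain \<open>S\<close>. The notion is only used where these derivatives are
  unique: for open \<open>S\<close>, and for relatively open subsets of nondegenerate intervals of the real line
  (one-sided derivatives at the end points).
\<close>

primrec Ck_on :: "nat \<Rightarrow> ('a::real_normed_vector \<Rightarrow> 'b::real_normed_vector) \<Rightarrow> 'a set \<Rightarrow> bool" where
  "Ck_on 0 f S \<longleftrightarrow> continuous_on S f"
| "Ck_on (Suc k) f S \<longleftrightarrow>
     (\<forall>x\<in>S. f differentiable (at x within S)) \<and>
     (\<forall>v. Ck_on k (\<lambda>x. frechet_derivative f (at x within S) v) S)"

definition smooth_on :: "'a::real_normed_vector set \<Rightarrow> ('a \<Rightarrow> 'b::real_normed_vector) \<Rightarrow> bool" where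
  "smooth_on S f \<longleftrightarrow> (\<forall>k. Ck_on k f S)"


section \<open>Smooth manifolds\<close>

text \<open>
  A chart is a pair of an open domain and a coordinate map. The values of the coordinate map
  outside the domain are irrelevant.
\<close>

type_synonym ('a, 'e) chart = "'a set \<times> ('a \<Rightarrow> 'e)"

definition chart_inv :: "('a, 'e) chart \<Rightarrow> 'e \<Rightarrow> 'a" where
  "chart_inv c = inv_into (fst c) (snd c)"

definition carrier :: "('a, 'e) chart set \<Rightarrow> 'a set" where
  "carrier A = (\<Union>c\<in>A. fst c)"

definition charts_at :: "('a, 'e) chart set \<Rightarrow> 'a \<Rightarrow> ('a, 'e) chart set" where
  "charts_at A p = {c \<in> A. p \<in> fst c}"

text \<open>
  The manifold is the open subset \<open>carrier A\<close> of a second countable Hausdorff space; its dimension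
  is \<open>DIM('e)\<close>. The atlas need not be maximal.
\<close>

definition smooth_manifold ::
  "('a::{second_countable_topology, t2_space}, 'e::euclidean_space) chart set \<Rightarrow> bool" where
  "smooth_manifold A \<longleftrightarrow>
     (\<forall>c\<in>A. open (fst c) \<and> open (snd c ` fst c) \<and>
        homeomorphism (fst c) (snd c ` fst c) (snd c) (chart_inv c)) \<and>
     (\<forall>c\<in>A. \<forall>d\<in>A. smooth_on (snd c ` (fst c \<inter> fst d)) (snd d \<circ> chart_inv c))"

definition smooth_into ::
  "('a::{second_countable_topology, t2_space}, 'e::euclidean_space) chart set
    \<Rightarrow> 'b::real_normed_vector set \<Rightarrow> ('b \<Rightarrow> 'a) \<Rightarrow> bool" where
  "smooth_into A S f \<longleftrightarrow>
     continuous_on S f \<and> f ` S \<subseteq> carrier A \<and>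
     (\<forall>d\<in>A. smooth_on (S \<inter> f -` fst d) (snd d \<circ> f))"

definition smooth_from ::
  "('a::{second_countable_topology, t2_space}, 'e::euclidean_space) chart set
    \<Rightarrow> 'a set \<Rightarrow> ('a \<Rightarrow> 'b::real_normed_vector) \<Rightarrow> bool" where
  "smooth_from A N h \<longleftrightarrow> (\<forall>d\<in>A. smooth_on (snd d ` (N \<inter> fst d)) (h \<circ> chart_inv d))"


section \<open>Tangent vectors\<close>

text \<open>
  A tangent vector at \<open>p\<close> is the family of its coordinate vectors in all charts around \<open>p\<close>,
  transforming by the Jacobians of the coordinate changes. The vector space operations are
  pointwise, and every chart \<open>c\<close> at \<open>p\<close> gives a linear isomorphism \<open>X \<mapsto> X c\<close> onto the model space,
  with inverse \<open>of_coord A p c\<close>.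
\<close>

type_synonym ('a, 'e) tvec = "('a, 'e) chart \<Rightarrow> 'e"

definition tangent_space ::
  "('a, 'e::euclidean_space) chart set \<Rightarrow> 'a \<Rightarrow> ('a, 'e) tvec set" where
  "tangent_space A p = {X.
     (\<forall>c\<in>charts_at A p. \<forall>d\<in>charts_at A p.
        X d = frechet_derivative (snd d \<circ> chart_inv c) (at (snd c p)) (X c)) \<and>
     (\<forall>c. c \<notin> charts_at A p \<longrightarrow> X c = 0)}"

definition of_coord ::
  "('a, 'e::euclidean_space) chart set \<Rightarrow> 'a \<Rightarrow> ('a, 'e) chart \<Rightarrow> 'e \<Rightarrow> ('a, 'e) tvec" where
  "of_coord A p c u = (\<lambda>d. if d \<in> charts_at A p
     then frechet_derivative (snd d \<circ> chart_inv c) (at (snd c p)) u else 0)"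

definition tscale :: "real \<Rightarrow> ('a, 'e::real_vector) tvec \<Rightarrow> ('a, 'e) tvec" where
  "tscale r X = (\<lambda>c. r *\<^sub>R X c)"

definition tadd :: "('a, 'e::real_vector) tvec \<Rightarrow> ('a, 'e) tvec \<Rightarrow> ('a, 'e) tvec" where
  "tadd X Y = (\<lambda>c. X c + Y c)"

text \<open>The velocity at time \<open>t\<close> of a curve defined on the interval \<open>I\<close>.\<close>

definition velocity ::
  "('a, 'e::euclidean_space) chart set \<Rightarrow> real set \<Rightarrow> (real \<Rightarrow> 'a) \<Rightarrow> real \<Rightarrow> ('a, 'e) tvec" where
  "velocity A I \<gamma> t = (\<lambda>c. if c \<in> charts_at A (\<gamma> t)
     then vector_derivative (snd c \<circ> \<gamma>) (at t within I) else 0)"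

definition regular_curve ::
  "('a::{second_countable_topology, t2_space}, 'e::euclidean_space) chart set
    \<Rightarrow> real set \<Rightarrow> (real \<Rightarrow> 'a) \<Rightarrow> bool" where
  "regular_curve A I \<alpha> \<longleftrightarrow>
     is_interval I \<and> interior I \<noteq> {} \<and> smooth_into A I \<alpha> \<and>
     (\<forall>s\<in>I. velocity A I \<alpha> s \<noteq> (\<lambda>c. 0))"


section \<open>Riemannian metrics and geodesics\<close>

type_synonym ('a, 'e) metric_tensor = "'a \<Rightarrow> ('a, 'e) tvec \<Rightarrow> ('a, 'e) tvec \<Rightarrow> real"

text \<open>The local expression of the metric in the chart \<open>c\<close>, at the point with coordinates \<open>x\<close>.\<close>

definition metric_coord ::
  "('a, 'e::euclidean_space) chart set \<Rightarrow> ('a, 'e) metric_tensor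
    \<Rightarrow> ('a, 'e) chart \<Rightarrow> 'e \<Rightarrow> 'e \<Rightarrow> 'e \<Rightarrow> real" where
  "metric_coord A g c x u v =
     g (chart_inv c x) (of_coord A (chart_inv c x) c u) (of_coord A (chart_inv c x) c v)"

definition riemannian_manifold ::
  "('a::{second_countable_topology, t2_space}, 'e::euclidean_space) chart set
    \<Rightarrow> ('a, 'e) metric_tensor \<Rightarrow> bool" where
  "riemannian_manifold A g \<longleftrightarrow>
     smooth_manifold A \<and>
     (\<forall>p\<in>carrier A.
        (\<forall>X\<in>tangent_space A p. \<forall>Y\<in>tangent_space A p. g p X Y = g p Y X) \<and>
        (\<forall>X\<in>tangent_space A p. \<forall>Y\<in>tangent_space A p. \<forall>Z\<in>tangent_space A p. \<forall>r.
           g p (tadd (tscale r X) Y) Z = r * g p X Z + g p Y Z) \<and>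
        (\<forall>X\<in>tangent_space A p. X \<noteq> (\<lambda>c. 0) \<longrightarrow> g p X X > 0)) \<and>
     (\<forall>c\<in>A. \<forall>u v. smooth_on (snd c ` fst c) (\<lambda>x. metric_coord A g c x u v))"

definition tnorm :: "('a, 'e) metric_tensor \<Rightarrow> 'a \<Rightarrow> ('a, 'e) tvec \<Rightarrow> real" where
  "tnorm g p X = sqrt (g p X X)"

text \<open>
  The Christoffel symbols of the Levi-Civita connection in the chart \<open>c\<close>, as the vector
  \<open>\<Gamma>\<^sup>k\<^sub>i\<^sub>j u\<^sup>i v\<^sup>j\<close>, with the index raised by nondegeneracy of the metric.
\<close>

definition christoffel ::
  "('a, 'e::euclidean_space) chart set \<Rightarrow> ('a, 'e) metric_tensor
    \<Rightarrow> ('a, 'e) chart \<Rightarrow> 'e \<Rightarrow> 'e \<Rightarrow> 'e \<Rightarrow> 'e" where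
  "christoffel A g c x u v = (THE z. \<forall>w.
     metric_coord A g c x z w =
       (frechet_derivative (\<lambda>y. metric_coord A g c y v w) (at x) u
      + frechet_derivative (\<lambda>y. metric_coord A g c y u w) (at x) v
      - frechet_derivative (\<lambda>y. metric_coord A g c y u v) (at x) w) / 2)"

definition geodesic ::
  "('a::{second_countable_topology, t2_space}, 'e::euclidean_space) chart set
    \<Rightarrow> ('a, 'e) metric_tensor \<Rightarrow> real set \<Rightarrow> (real \<Rightarrow> 'a) \<Rightarrow> bool" where
  "geodesic A g J \<gamma> \<longleftrightarrow>
     smooth_into A J \<gamma> \<and>
     (\<forall>t\<in>J. \<forall>c\<in>charts_at A (\<gamma> t).
        vector_derivative (\<lambda>\<tau>. vector_derivative (snd c \<circ> \<gamma>) (at \<tau> within J)) (at t within J)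
        + christoffel A g c (snd c (\<gamma> t))
            (vector_derivative (snd c \<circ> \<gamma>) (at t within J))
            (vector_derivative (snd c \<circ> \<gamma>) (at t within J)) = 0)"


section \<open>Exponential map, injectivity radius, geodesic spheres\<close>

text \<open>
  \<open>exp\<^sub>p v = \<gamma>\<^sub>v(1)\<close>, for the vectors \<open>v\<close> such that the geodesic \<open>\<gamma>\<^sub>v\<close> with initial velocity \<open>v\<close> is
  defined on \<open>[0,1]\<close>. The description in the definition of \<open>exp_map\<close> is proper because geodesics
  are determined by their initial velocity.
\<close>

definition geodesic_from ::
  "('a::{second_countable_topology, t2_space}, 'e::euclidean_space) chart set
    \<Rightarrow> ('a, 'e) metric_tensor \<Rightarrow> 'a \<Rightarrow> ('a, 'e) tvec \<Rightarrow> (real \<Rightarrow> 'a) \<Rightarrow> bool" where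
  "geodesic_from A g p v \<gamma> \<longleftrightarrow>
     geodesic A g {0..1} \<gamma> \<and> \<gamma> 0 = p \<and> velocity A {0..1} \<gamma> 0 = v"

definition exp_domain ::
  "('a::{second_countable_topology, t2_space}, 'e::euclidean_space) chart set
    \<Rightarrow> ('a, 'e) metric_tensor \<Rightarrow> 'a \<Rightarrow> ('a, 'e) tvec set" where
  "exp_domain A g p = {v \<in> tangent_space A p. \<exists>\<gamma>. geodesic_from A g p v \<gamma>}"

definition exp_map ::
  "('a::{second_countable_topology, t2_space}, 'e::euclidean_space) chart set
    \<Rightarrow> ('a, 'e) metric_tensor \<Rightarrow> 'a \<Rightarrow> ('a, 'e) tvec \<Rightarrow> 'a" where
  "exp_map A g p v = (THE q. \<exists>\<gamma>. geodesic_from A g p v \<gamma> \<and> q = \<gamma> 1)"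

definition tball ::
  "('a, 'e::euclidean_space) chart set \<Rightarrow> ('a, 'e) metric_tensor \<Rightarrow> 'a \<Rightarrow> real
    \<Rightarrow> ('a, 'e) tvec set" where
  "tball A g p r = {v \<in> tangent_space A p. tnorm g p v < r}"

text \<open>
  \<open>exp\<^sub>p\<close> restricted to \<open>B \<subseteq> T\<^sub>pM\<close> is a diffeomorphism onto an open subset of the manifold. The smooth
  structure of \<open>T\<^sub>pM\<close> is read off in the linear coordinates given by a chart \<open>c\<close> at \<open>p\<close>.
\<close>

definition exp_diffeo_on ::
  "('a::{second_countable_topology, t2_space}, 'e::euclidean_space) chart set
    \<Rightarrow> ('a, 'e) metric_tensor \<Rightarrow> 'a \<Rightarrow> ('a, 'e) tvec set \<Rightarrow> bool" where
  "exp_diffeo_on A g p B \<longleftrightarrow>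
     B \<subseteq> exp_domain A g p \<and> inj_on (exp_map A g p) B \<and> open (exp_map A g p ` B) \<and>
     (\<forall>c\<in>charts_at A p.
        smooth_into A ((\<lambda>v. v c) ` B) (exp_map A g p \<circ> of_coord A p c) \<and>
        smooth_from A (exp_map A g p ` B) (\<lambda>q. the_inv_into B (exp_map A g p) q c))"

definition injectivity_radius ::
  "('a::{second_countable_topology, t2_space}, 'e::euclidean_space) chart set
    \<Rightarrow> ('a, 'e) metric_tensor \<Rightarrow> 'a \<Rightarrow> ereal" where
  "injectivity_radius A g p = Sup {ereal r | r. 0 \<le> r \<and> exp_diffeo_on A g p (tball A g p r)}"

definition geodesic_sphere ::
  "('a::{second_countable_topology, t2_space}, 'e::euclidean_space) chart set
    \<Rightarrow> ('a, 'e) metric_tensor \<Rightarrow> 'a \<Rightarrow> real \<Rightarrow> 'a set" where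
  "geodesic_sphere A g p \<delta> = exp_map A g p ` {v \<in> tangent_space A p. tnorm g p v = \<delta>}"

definition lies_on_geodesic_sphere ::
  "('a::{second_countable_topology, t2_space}, 'e::euclidean_space) chart set
    \<Rightarrow> ('a, 'e) metric_tensor \<Rightarrow> 'a \<Rightarrow> real set \<Rightarrow> (real \<Rightarrow> 'a) \<Rightarrow> bool" where
  "lies_on_geodesic_sphere A g p I \<alpha> \<longleftrightarrow>
     (\<exists>\<delta>>0. ereal \<delta> < injectivity_radius A g p \<and> \<alpha> ` I \<subseteq> geodesic_sphere A g p \<delta>)"


section \<open>Normal curves\<close>

definition radial_geodesic ::
  "('a::{second_countable_topology, t2_space}, 'e::euclidean_space) chart set
    \<Rightarrow> ('a, 'e) metric_tensor \<Rightarrow> 'a \<Rightarrow> ('a, 'e) tvec \<Rightarrow> real \<Rightarrow> 'a" where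
  "radial_geodesic A g p v = (\<lambda>t. exp_map A g p (tscale t v))"

text \<open>
  The radial geodesic connecting \<open>p\<close> to \<open>\<alpha>(s)\<close> is \<open>t \<mapsto> exp\<^sub>p(t v)\<close> on \<open>[0,1]\<close>, where \<open>v\<close> is the vector of
  norm less than the injectivity radius with \<open>exp\<^sub>p v = \<alpha>(s)\<close>; it is unique as \<open>exp\<^sub>p\<close> is injective
  on that ball.
\<close>

definition normal_curve ::
  "('a::{second_countable_topology, t2_space}, 'e::euclidean_space) chart set
    \<Rightarrow> ('a, 'e) metric_tensor \<Rightarrow> 'a \<Rightarrow> real set \<Rightarrow> (real \<Rightarrow> 'a) \<Rightarrow> bool" where
  "normal_curve A g p I \<alpha> \<longleftrightarrow>
     regular_curve A I \<alpha> \<and>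
     (\<forall>s\<in>I. \<exists>v\<in>tangent_space A p.
        ereal (tnorm g p v) < injectivity_radius A g p \<and> exp_map A g p v = \<alpha> s \<and>
        g (\<alpha> s) (velocity A I \<alpha> s) (velocity A {0..1} (radial_geodesic A g p v) 1) = 0)"

end

theory Submission
  imports Defs
begin

text \<open>
  If the injectivity radius at \<open>p\<close> is not positive, no curve is normal and none lies on a geodesic
  sphere, so \<open>W\<close> can be the whole manifold. Otherwise \<open>exp\<^sub>p\<close> is by definition a diffeomorphism on a
  ball of positive radius, so neither existence of geodesics nor the inverse function theorem is
  needed. Take for \<open>W\<close> the image of a smaller ball, inside the domain of one chart. A curve in
  \<open>W - {p}\<close> is \<open>\<alpha>(s) = exp\<^sub>p(w(s))\<close> with \<open>w\<close> differentiable, and the Gauss lemma says that the product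
  of \<open>\<alpha>'(s)\<close> with the velocity of the radial geodesic is \<open>\<langle>w'(s), w(s)\<rangle>\<close>, half of the derivative of
  \<open>\<parallel>w(s)\<parallel>\<^sup>2\<close>. It vanishes identically iff \<open>\<parallel>w\<parallel>\<close> is constant. Uniqueness of geodesics, by a Gronwall
  estimate in charts, identifies \<open>t \<mapsto> exp\<^sub>p(t v)\<close> with a geodesic.
\<close>

section \<open>Calculus\<close>

text \<open>Two descriptions by \<open>THE\<close> shape the proof. \<open>exp_map\<close> picks the
  end point of a separate geodesic for each vector, so nothing in its definition says that the
  points \<open>exp_map A g p (tscale t v)\<close> trace a single geodesic; rescaling the parameter
  and uniqueness supply this. \<open>christoffel\<close> solves an equation tested against all
  vectors, and the proof keeps the geodesic equation in this tested form, G x x'' w = - \<Gamma>1 x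
  x' w. Estimates then rest on a lower bound c |u|^2 for the metric on compact sets instead of an
  inverse matrix, and the Gauss lemma needs only the test vectors x' and J. In one chart everything
  becomes a statement about a C^2 family G of inner products and a C^2 map \<Phi> on open subsets of
  a Euclidean space. Derivatives of curves are taken within their interval, so that end points
  count; part of the preliminary work passes between this interval and the part of it that a chart
  covers.\<close>

lemma frechet_derivative_within_cong:
  assumes "x \<in> S" "\<And>y. y \<in> S \<Longrightarrow> f y = g y"
  shows "frechet_derivative f (at x within S) = frechet_derivative g (at x within S)"
proof -
  have "(f has_derivative D) (at x within S) \<longleftrightarrow> (g has_derivative D) (at x within S)" for D
    using assms by (metis has_derivative_transform)
  then show ?thesis
    by (simp add: frechet_derivative_def)
qed

lemma vector_derivative_cong_on:
  assumes "x \<in> S" "\<And>y. y \<in> S \<Longrightarrow> f y = g y"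
  shows "vector_derivative f (at x within S) = vector_derivative g (at x within S)"
proof -
  have "(f has_vector_derivative D) (at x within S) \<longleftrightarrow> (g has_vector_derivative D) (at x within S)" for D
    using assms by (metis has_vector_derivative_transform)
  then show ?thesis
    by (simp add: vector_derivative_def)
qed

lemma Ck_on_cong:
  assumes "\<And>x. x \<in> S \<Longrightarrow> f x = g x"
  shows "Ck_on k f S \<longleftrightarrow> Ck_on k g S"
  using assms
proof (induction k arbitrary: f g)
  case 0
  then show ?case by (auto intro: continuous_on_cong)
next
  case (Suc k)
  have "f differentiable (at x within S) \<longleftrightarrow> g differentiable (at x within S)" if "x \<in> S" for x
    using that Suc.prems by (metis differentiable_def has_derivative_transform)
  moreover have "Ck_on k (\<lambda>x. frechet_derivative f (at x within S) v) S \<longleftrightarrow>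
      Ck_on k (\<lambda>x. frechet_derivative g (at x within S) v) S" for v
    by (rule Suc.IH) (use Suc.prems frechet_derivative_within_cong in metis)
  ultimately show ?case by simp
qed

lemma Ck_on_imp_continuous_on: "Ck_on k f S \<Longrightarrow> continuous_on S f"
  by (cases k) (auto intro!: differentiable_imp_continuous_on simp: differentiable_on_def)

lemma Ck_on_SucD: "Ck_on (Suc k) f S \<Longrightarrow> Ck_on k f S"
proof (induction k arbitrary: f)
  case 0
  then show ?case using Ck_on_imp_continuous_on[OF 0] by simp
next
  case (Suc k)
  then show ?case by (subst Ck_on.simps(2), subst (asm) (2) Ck_on.simps(2)) blast
qed

text \<open>On an open set the derivatives within \<open>S\<close> are full derivatives; later
  arguments on open sets use this form.\<close>

lemma Ck_on_open_Suc:
  assumes "open S" "Ck_on (Suc k) f S"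
  shows "x \<in> S \<Longrightarrow> (f has_derivative frechet_derivative f (at x)) (at x)"
    and "Ck_on k (\<lambda>x. frechet_derivative f (at x) v) S"
proof -
  show "(f has_derivative frechet_derivative f (at x)) (at x)" if "x \<in> S"
    using assms that by (metis Ck_on.simps(2) at_within_open frechet_derivative_works)
  have "Ck_on k (\<lambda>x. frechet_derivative f (at x within S) v) S"
    using assms by simp
  then show "Ck_on k (\<lambda>x. frechet_derivative f (at x) v) S"
    by (rule Ck_on_cong[THEN iffD1, rotated]) (simp add: at_within_open[OF _ assms(1)])
qed

lemma Ck_on_open_subset:
  assumes "open S" "open T" "T \<subseteq> S" "Ck_on k f S"
  shows "Ck_on k f T"
  using assms(4)
proof (induction k arbitrary: f)
  case 0
  then show ?case using assms(3) continuous_on_subset by auto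
next
  case (Suc k)
  note d = Ck_on_open_Suc[OF assms(1) Suc.prems]
  have "Ck_on k (\<lambda>x. frechet_derivative f (at x within T) v) T" for v
    by (rule Ck_on_cong[THEN iffD1, rotated, OF Suc.IH[OF d(2)]]) (simp add: at_within_open[OF _ assms(2)])
  moreover have "f differentiable (at x within T)" if "x \<in> T" for x
    by (rule differentiableI, rule has_derivative_at_withinI, rule d(1)) (use that assms(3) in blast)
  ultimately show ?case by simp
qed

lemma smooth_on_open:
  assumes "open S" "smooth_on S f"
  shows "x \<in> S \<Longrightarrow> (f has_derivative frechet_derivative f (at x)) (at x)"
    and "continuous_on S f"
  using assms Ck_on_open_Suc[OF assms(1)] Ck_on_imp_continuous_on unfolding smooth_on_def by blast+

lemma has_vector_derivative_chain:
  assumes "(f has_derivative f') (at (q t))" "(q has_vector_derivative q') (at t within S)"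
  shows "((\<lambda>t. f (q t)) has_vector_derivative f' q') (at t within S)"
  using diff_chain_within[OF assms(2)[unfolded has_vector_derivative_def] has_derivative_at_withinI[OF assms(1)]]
    has_derivative_linear[OF assms(1)]
  by (simp add: has_vector_derivative_def o_def linear_scale)

lemma linear_eq_sum_Basis:
  fixes f :: "'a::euclidean_space \<Rightarrow> 'b::real_vector"
  assumes "linear f"
  shows "f u = (\<Sum>b\<in>Basis. (u \<bullet> b) *\<^sub>R f b)"
proof -
  have "f u = f (\<Sum>b\<in>Basis. (u \<bullet> b) *\<^sub>R b)" by (simp add: euclidean_representation)
  then show ?thesis by (simp add: linear_sum[OF assms] linear_scale[OF assms])
qed

text \<open>The partial derivatives are bounded on the compact set, and convexity allows the mean
  value inequality. This provides Lipschitz constants for the coefficients of the metric and for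
  their first derivatives.\<close>

lemma Ck_on_imp_lipschitz:
  fixes h :: "'a::euclidean_space \<Rightarrow> real"
  assumes "open V" "Ck_on (Suc 0) h V" "compact K" "convex K" "K \<subseteq> V"
  obtains L where "0 \<le> L" "\<And>x y. x \<in> K \<Longrightarrow> y \<in> K \<Longrightarrow> \<bar>h x - h y\<bar> \<le> L * norm (x - y)"
proof -
  note d = Ck_on_open_Suc[OF assms(1,2)]
  have "\<exists>M. \<forall>x\<in>K. \<bar>frechet_derivative h (at x) b\<bar> \<le> M" for b
  proof -
    have "continuous_on K (\<lambda>x. frechet_derivative h (at x) b)"
      using d(2)[of b] assms(5) continuous_on_subset by auto
    then have "bounded ((\<lambda>x. frechet_derivative h (at x) b) ` K)"
      using assms(3) compact_continuous_image compact_imp_bounded by blast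
    then show ?thesis by (auto simp: bounded_iff)
  qed
  then obtain M where M: "\<And>b x. x \<in> K \<Longrightarrow> \<bar>frechet_derivative h (at x) b\<bar> \<le> M b" by metis
  \<comment> \<open>The derivative at \<open>u\<close> is a combination of its values on
    \<open>Basis\<close> with coefficients at most \<open>norm u\<close>, so the sum of the bounds
    dominates the operator norm.\<close>
  define L where "L = (\<Sum>b\<in>Basis. \<bar>M (b::'a)\<bar>)"
  have L0: "0 \<le> L" unfolding L_def by (simp add: sum_nonneg)
  have on: "onorm (frechet_derivative h (at x)) \<le> L" if x: "x \<in> K" for x
  proof (rule onorm_bound[OF L0])
    fix u
    have lin: "linear (frechet_derivative h (at x))"
      using d(1) x assms(5) has_derivative_linear by blast
    have "norm (frechet_derivative h (at x) u) = \<bar>\<Sum>b\<in>Basis. (u \<bullet> b) * frechet_derivative h (at x) b\<bar>"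
      by (subst linear_eq_sum_Basis[OF lin]) simp
    also have "\<dots> \<le> (\<Sum>b\<in>Basis. \<bar>(u \<bullet> b) * frechet_derivative h (at x) b\<bar>)"
      by (rule sum_abs)
    also have "\<dots> \<le> (\<Sum>b\<in>Basis. norm u * \<bar>M b\<bar>)"
      using M[OF x] by (intro sum_mono) (auto simp: abs_mult Basis_le_norm intro!: mult_mono intro: order_trans[OF _ abs_ge_self])
    finally show "norm (frechet_derivative h (at x) u) \<le> L * norm u"
      by (simp add: L_def sum_distrib_left mult.commute)
  qed
  have "\<bar>h x - h y\<bar> \<le> L * norm (x - y)" if "x \<in> K" "y \<in> K" for x y
  proof -
    have "norm (h x - h y) \<le> L * norm (x - y)"
      using d(1) assms(4,5) on that
      by (intro differentiable_bound[where S=K and f'="\<lambda>x. frechet_derivative h (at x)"])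
        (auto intro: has_derivative_at_withinI)
    then show ?thesis by simp
  qed
  with L0 that show thesis by blast
qed

section \<open>Symmetry of second derivatives and a Gronwall inequality\<close>

text \<open>Integrate along \<open>w\<close> and differentiate under the integral in direction
  \<open>u\<close>; the fundamental theorem of calculus recovers the mixed derivative in the other
  order. Continuity of the one mixed derivative \<open>B\<close> justifies both operations.\<close>

lemma frechet_derivative_symmetric:
  fixes f :: "'a::euclidean_space \<Rightarrow> 'b::euclidean_space"
  assumes U: "open U" and C2: "Ck_on (Suc (Suc 0)) f U" and y: "y \<in> U"
  shows "frechet_derivative (\<lambda>x. frechet_derivative f (at x) u) (at y) w =
    frechet_derivative (\<lambda>x. frechet_derivative f (at x) w) (at y) u"
proof -
  define D where "D = (\<lambda>v x. frechet_derivative f (at x) v)"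
  define B where "B = (\<lambda>x. frechet_derivative (D w) (at x) u)"
  have fd: "(f has_derivative (\<lambda>v. D v x)) (at x)" if "x \<in> U" for x
    using Ck_on_open_Suc(1)[OF U C2 that] by (simp add: D_def)
  have DC: "Ck_on (Suc 0) (D v) U" for v
    using Ck_on_open_Suc(2)[OF U C2] by (simp add: D_def)
  have Dd: "(D v has_derivative frechet_derivative (D v) (at x)) (at x)" if "x \<in> U" for x v
    using Ck_on_open_Suc(1)[OF U DC that] .
  have Bc: "continuous_on U B"
    using Ck_on_open_Suc(2)[OF U DC] by (simp add: B_def)
  obtain e where e: "0 < e" "ball y e \<subseteq> U"
    using U y open_contains_ball by blast
  \<comment> \<open>All displacements \<open>t *\<^sub>R w + s *\<^sub>R u\<close> with t, s in
    [0, r] then have norm below e / 2; the summand 1 keeps the denominator positive when u = w =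
    0.\<close>
  define r where "r = e / (2 * (norm u + norm w + 1))"
  have pos: "norm u + norm w + 1 > 0"
    using norm_ge_zero[of u] norm_ge_zero[of w] by linarith
  have r: "0 < r" using e pos by (simp add: r_def)
  have inU: "y + t *\<^sub>R w + s *\<^sub>R u \<in> U" if "t \<in> {0..r}" "s \<in> {0..r}" for t s
  proof -
    have "norm (t *\<^sub>R w + s *\<^sub>R u) \<le> \<bar>t\<bar> * norm w + \<bar>s\<bar> * norm u"
      by (metis norm_scaleR norm_triangle_ineq)
    also have "\<dots> \<le> r * norm w + r * norm u"
      using that by (intro add_mono mult_right_mono) auto
    also have "\<dots> < r * (norm u + norm w + 1)"
      using r by (simp add: algebra_simps)
    also have "\<dots> = e / 2" using pos by (simp add: r_def field_simps)
    also have "\<dots> < e" using e by simp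
    finally have "dist (y + (t *\<^sub>R w + s *\<^sub>R u)) y < e" by (simp add: dist_norm)
    then have "y + (t *\<^sub>R w + s *\<^sub>R u) \<in> ball y e" by (simp add: dist_commute)
    with e(2) show ?thesis by (auto simp: add.assoc)
  qed
  define P where "P = (\<lambda>t s. y + t *\<^sub>R w + s *\<^sub>R u)"
  have inU': "P t s \<in> U" if "t \<in> {0..r}" "s \<in> {0..r}" for t s
    using inU that by (simp add: P_def)
  have Pt: "((\<lambda>t. P t s) has_derivative (\<lambda>h. h *\<^sub>R w)) (at t within S)" for t s S
    unfolding P_def by (auto intro!: derivative_eq_intros)
  have Ps: "((\<lambda>s. P t s) has_derivative (\<lambda>h. h *\<^sub>R u)) (at s within S)" for t s S
    unfolding P_def by (auto intro!: derivative_eq_intros)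
  have chain_t: "((\<lambda>t. h (P t s)) has_vector_derivative h' w) (at t within S)"
    if "(h has_derivative h') (at (P t s))" for h :: "'a \<Rightarrow> 'b" and h' t s S
    using diff_chain_within[OF Pt has_derivative_at_withinI[OF that]] has_derivative_linear[OF that]
    by (simp add: has_vector_derivative_def o_def linear_scale)
  have chain_s: "((\<lambda>s. h (P t s)) has_vector_derivative h' u) (at s within S)"
    if "(h has_derivative h') (at (P t s))" for h :: "'a \<Rightarrow> 'b" and h' t s S
    using diff_chain_within[OF Ps has_derivative_at_withinI[OF that]] has_derivative_linear[OF that]
    by (simp add: has_vector_derivative_def o_def linear_scale)
  have Bc2: "continuous_on ({0..r} \<times> cbox 0 r) (\<lambda>(s, t). B (P t s))"
    unfolding split_beta
    by (rule continuous_on_compose2[OF Bc]) (auto simp: P_def intro!: continuous_intros inU)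
  have ftc: "f (P t s) = f (P 0 s) + integral (cbox 0 t) (\<lambda>\<tau>. D w (P \<tau> s))"
    and int: "(\<lambda>\<tau>. D w (P \<tau> s)) integrable_on cbox 0 t"
    if "t \<in> {0..r}" "s \<in> {0..r}" for t s
  proof -
    have "((\<lambda>\<tau>. f (P \<tau> s)) has_vector_derivative D w (P \<tau> s)) (at \<tau> within {0..t})"
      if "\<tau> \<in> {0..t}" for \<tau>
      using that \<open>t \<in> {0..r}\<close> \<open>s \<in> {0..r}\<close> by (intro chain_t[OF fd[OF inU']]) auto
    then have "((\<lambda>\<tau>. D w (P \<tau> s)) has_integral (f (P t s) - f (P 0 s))) {0..t}"
      using that by (intro fundamental_theorem_of_calculus) auto
    then show "f (P t s) = f (P 0 s) + integral (cbox 0 t) (\<lambda>\<tau>. D w (P \<tau> s))"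
      "(\<lambda>\<tau>. D w (P \<tau> s)) integrable_on cbox 0 t"
      by (auto simp: integral_unique has_integral_integrable)
  qed
  \<comment> \<open>Both sides are the derivative of f(P t s) at s = 0: directly on the left,
    through \<open>ftc\<close> and differentiation under the integral on the right.\<close>
  have eq: "D u (P t 0) = D u (P 0 0) + integral {0..t} (\<lambda>\<tau>. B (P \<tau> 0))" if t: "t \<in> {0..r}" for t
  proof -
    have 1: "((\<lambda>s. integral (cbox 0 t) (\<lambda>\<tau>. D w (P \<tau> s))) has_vector_derivative
        integral (cbox 0 t) (\<lambda>\<tau>. B (P \<tau> 0))) (at 0 within {0..r})"
    proof (rule leibniz_rule_vector_derivative)
      show "((\<lambda>s. D w (P \<tau> s)) has_vector_derivative B (P \<tau> s)) (at s within {0..r})"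
        if "s \<in> {0..r}" "\<tau> \<in> cbox 0 t" for s \<tau>
        unfolding B_def by (rule chain_s[OF Dd[OF inU']]) (use that t in auto)
      show "continuous_on ({0..r} \<times> cbox 0 t) (\<lambda>(s, \<tau>). B (P \<tau> s))"
        by (rule continuous_on_subset[OF Bc2]) (use t in auto)
    qed (use int t r in auto)
    have 2: "((\<lambda>s. f (P 0 s)) has_vector_derivative D u (P 0 0)) (at 0 within {0..r})"
      by (rule chain_s[OF fd[OF inU']]) (use r in auto)
    have "((\<lambda>s. f (P t s)) has_vector_derivative
        D u (P 0 0) + integral (cbox 0 t) (\<lambda>\<tau>. B (P \<tau> 0))) (at 0 within {0..r})"
      by (rule has_vector_derivative_transform[OF _ _ has_vector_derivative_add[OF 2 1]])
        (use r in simp, rule ftc[OF t])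
    moreover have "((\<lambda>s. f (P t s)) has_vector_derivative D u (P t 0)) (at 0 within {0..r})"
      by (rule chain_s[OF fd[OF inU']]) (use r t in auto)
    ultimately show ?thesis
      using vector_derivative_unique_within_closed_interval[of 0 r 0] r by auto
  qed
  \<comment> \<open>It remains to differentiate \<open>eq\<close> at t = 0: the integral yields
    \<open>B\<close> at y, the left side the mixed derivative in the other order.\<close>
  have "continuous_on {0..r} (\<lambda>\<tau>. B (P \<tau> 0))"
    by (rule continuous_on_compose2[OF Bc]) (use r inU'[of _ 0] in \<open>auto simp: P_def intro!: continuous_intros\<close>)
  then have "((\<lambda>t. integral {0..t} (\<lambda>\<tau>. B (P \<tau> 0))) has_vector_derivative B (P 0 0)) (at 0 within {0..r})"
    using r by (intro integral_has_vector_derivative) auto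
  then have "((\<lambda>t. D u (P 0 0) + integral {0..t} (\<lambda>\<tau>. B (P \<tau> 0))) has_vector_derivative B (P 0 0)) (at 0 within {0..r})"
    using has_vector_derivative_add[OF has_vector_derivative_const[of "D u (P 0 0)"]] by simp
  then have "((\<lambda>t. D u (P t 0)) has_vector_derivative B (P 0 0)) (at 0 within {0..r})"
    by (rule has_vector_derivative_transform[rotated 2]) (use r in simp, rule eq)
  moreover have "((\<lambda>t. D u (P t 0)) has_vector_derivative frechet_derivative (D u) (at (P 0 0)) w) (at 0 within {0..r})"
    by (rule chain_t[OF Dd[OF inU']]) (use r in auto)
  ultimately have "frechet_derivative (D u) (at (P 0 0)) w = B (P 0 0)"
    using vector_derivative_unique_within_closed_interval[of 0 r 0] r by auto
  then show ?thesis
    by (simp add: B_def D_def P_def)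
qed

text \<open>The integrating factor exp(- C t) turns the differential inequality into monotonicity:
  the product with \<phi> is nonincreasing and starts at 0.\<close>

lemma gronwall_zero:
  fixes \<phi> \<phi>' :: "real \<Rightarrow> real"
  assumes d: "\<And>t. t \<in> {a..b} \<Longrightarrow> (\<phi> has_real_derivative \<phi>' t) (at t within {a..b})"
    and le: "\<And>t. t \<in> {a..b} \<Longrightarrow> \<phi>' t \<le> C * \<phi> t"
    and "\<phi> a = 0" "t \<in> {a..b}"
  shows "\<phi> t \<le> 0"
proof -
  define \<psi> where "\<psi> = (\<lambda>t. \<phi> t * exp (- C * t))"
  have d': "(\<psi> has_real_derivative (\<phi>' s - C * \<phi> s) * exp (- C * s)) (at s within {a..b})"
    if "s \<in> {a..b}" for s
    unfolding \<psi>_def by (rule derivative_eq_intros d that refl | simp add: algebra_simps)+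
  have "\<psi> t \<le> \<psi> a"
  proof (rule DERIV_nonpos_imp_decreasing_open[where f=\<psi>])
    show "a \<le> t" using assms by simp
    show "\<exists>y. DERIV \<psi> s :> y \<and> y \<le> 0" if "a < s" "s < t" for s
    proof -
      have s: "s \<in> {a..b}" "s \<in> interior {a..b}" using that assms by auto
      have "(\<psi> has_real_derivative (\<phi>' s - C * \<phi> s) * exp (- C * s)) (at s)"
        using d'[OF s(1)] at_within_interior[OF s(2)] by simp
      moreover have "(\<phi>' s - C * \<phi> s) * exp (- C * s) \<le> 0"
        by (rule mult_nonpos_nonneg) (use le[OF s(1)] in simp_all)
      ultimately show ?thesis by (intro exI conjI)
    qed
    have "continuous_on {a..b} \<psi>"
      by (rule DERIV_continuous_on[OF d'])
    then show "continuous_on {a..t} \<psi>"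
      by (rule continuous_on_subset) (use assms in auto)
  qed
  then show ?thesis using assms by (simp add: \<psi>_def mult_le_0_iff)
qed

section \<open>Derivatives of curves on intervals\<close>

lemma continuous_on_open_nbhd:
  fixes J :: "real set"
  assumes "continuous_on J \<gamma>" "open N" "t \<in> J" "\<gamma> t \<in> N"
  obtains e where "0 < e" "\<And>s. s \<in> J \<Longrightarrow> dist s t < e \<Longrightarrow> \<gamma> s \<in> N"
proof -
  have "\<forall>\<^sub>F s in at t within J. \<gamma> s \<in> N"
    using assms unfolding continuous_on_def by (blast intro: topological_tendstoD)
  then obtain e where "0 < e" "\<And>s. s \<in> J \<Longrightarrow> s \<noteq> t \<Longrightarrow> dist s t < e \<Longrightarrow> \<gamma> s \<in> N"
    unfolding eventually_at by blast
  then show thesis using that assms(4) by metis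
qed

text \<open>\<open>smooth_into\<close> differentiates within the part of the domain that a chart
  covers, while \<open>velocity\<close> and \<open>geodesic\<close> differentiate within the whole
  domain. By continuity the two sets agree near \<open>t\<close>.\<close>

lemma at_within_vimage:
  fixes J :: "real set"
  assumes "continuous_on J \<gamma>" "open N" "t \<in> J" "\<gamma> t \<in> N"
  shows "at t within (J \<inter> \<gamma> -` N) = at t within J"
proof -
  obtain e where "0 < e" "\<And>s. s \<in> J \<Longrightarrow> dist s t < e \<Longrightarrow> \<gamma> s \<in> N"
    using continuous_on_open_nbhd[OF assms] by metis
  then show ?thesis
    by (intro at_within_nhd[where S="ball t e"]) (auto simp: dist_commute)
qed

text \<open>No point of a nondegenerate interval is isolated, so derivatives within it are unique,
  end points included.\<close>

lemma at_within_interval_ne_bot: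
  fixes I :: "real set"
  assumes "is_interval I" "interior I \<noteq> {}" "t \<in> I"
  shows "at t within I \<noteq> bot"
proof -
  have "I \<noteq> {x}" for x using assms(2) by auto
  then have "t islimpt I"
    using connected_imp_perfect[OF is_interval_connected[OF assms(1)] assms(3)] by blast
  then show ?thesis by (simp add: trivial_limit_within)
qed

lemma has_vector_derivative_frechet:
  fixes f :: "real \<Rightarrow> 'b::real_normed_vector"
  assumes "f differentiable (at t within S)"
  shows "(f has_vector_derivative frechet_derivative f (at t within S) 1) (at t within S)"
proof -
  have *: "(f has_derivative frechet_derivative f (at t within S)) (at t within S)"
    using assms frechet_derivative_works by blast
  have "frechet_derivative f (at t within S) = (\<lambda>h. h *\<^sub>R frechet_derivative f (at t within S) 1)"
  proof
    fix h :: real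
    show "frechet_derivative f (at t within S) h = h *\<^sub>R frechet_derivative f (at t within S) 1"
      using linear_scale[OF has_derivative_linear[OF *], of h 1] by simp
  qed
  with * show ?thesis by (simp add: has_vector_derivative_def)
qed

text \<open>For geodesics reparametrized by a factor t. The sets need not be open, so
  \<open>frechet_derivative\<close> within \<open>S'\<close> is identified with the result of the
  chain rule through the absence of isolated points.\<close>

lemma Ck_on_rescale:
  fixes f :: "real \<Rightarrow> 'b::real_normed_vector"
  assumes "Ck_on k f S" "\<And>x. x \<in> S' \<Longrightarrow> t * x \<in> S" "\<And>x. x \<in> S' \<Longrightarrow> at x within S' \<noteq> bot"
  shows "Ck_on k (\<lambda>x. f (t * x)) S'"
  using assms(1)
proof (induction k arbitrary: f)
  case 0
  then show ?case
    using assms(2) by (auto intro!: continuous_on_compose2[where f="\<lambda>x. t * x"] continuous_intros)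
next
  case (Suc k)
  define F where "F = (\<lambda>x. frechet_derivative f (at x within S))"
  have der: "((\<lambda>x. f (t * x)) has_derivative (\<lambda>h. F (t * x) (t * h))) (at x within S')" if x: "x \<in> S'" for x
  proof -
    have "(f has_derivative F (t * x)) (at (t * x) within S)"
      using Suc.prems assms(2)[OF x] frechet_derivative_works by (auto simp: F_def)
    then have "(f has_derivative F (t * x)) (at (t * x) within (\<lambda>x. t * x) ` S')"
      by (rule has_derivative_subset) (use assms(2) in auto)
    moreover have "((\<lambda>x. t * x) has_derivative (\<lambda>h. t * h)) (at x within S')"
      by (auto intro!: derivative_eq_intros)
    ultimately show ?thesis using diff_chain_within[of "\<lambda>x. t * x"] by (simp add: o_def)
  qed
  have eq: "frechet_derivative (\<lambda>x. f (t * x)) (at x within S') v = F (t * x) (t * v)" if x: "x \<in> S'" for x v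
  proof -
    have d: "(\<lambda>x. f (t * x)) differentiable (at x within S')"
      using der[OF x] differentiable_def by blast
    have "F (t * x) (t * 1) = frechet_derivative (\<lambda>x. f (t * x)) (at x within S') 1"
    proof (rule vector_derivative_unique_within[OF assms(3)[OF x]])
      show "((\<lambda>x. f (t * x)) has_vector_derivative F (t * x) (t * 1)) (at x within S')"
      proof -
        have "(\<lambda>h. F (t * x) (t * h)) = (\<lambda>h. h *\<^sub>R F (t * x) (t * 1))"
        proof
          fix h :: real
          show "F (t * x) (t * h) = h *\<^sub>R F (t * x) (t * 1)"
            using linear_scale[OF has_derivative_linear[OF der[OF x]], of h 1] by simp
        qed
        then show ?thesis using der[OF x] by (simp add: has_vector_derivative_def)
      qed
    qed (rule has_vector_derivative_frechet[OF d])
    moreover have "linear (frechet_derivative (\<lambda>x. f (t * x)) (at x within S'))"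
      using d frechet_derivative_works has_derivative_linear by blast
    ultimately show ?thesis
      using linear_scale[of "frechet_derivative (\<lambda>x. f (t * x)) (at x within S')" v 1]
        linear_scale[OF has_derivative_linear[OF der[OF x]], of v 1]
      by simp
  qed
  \<comment> \<open>The factor from the chain rule moves into the direction: the induction
    hypothesis applies to the derivative of f in the fixed direction t * v.\<close>
  have "Ck_on k (\<lambda>x. F (t * x) (t * v)) S'" for v
    using Suc.prems by (intro Suc.IH[of "\<lambda>x. F x (t * v)"]) (simp add: F_def)
  then have "Ck_on k (\<lambda>x. frechet_derivative (\<lambda>x. f (t * x)) (at x within S') v) S'" for v
    by (rule Ck_on_cong[THEN iffD1, rotated]) (simp add: eq)
  then show ?case by (auto intro: differentiableI der)
qed

section \<open>Linear forms in finite dimension\<close>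

text \<open>A positive definite form is nondegenerate, so z \<mapsto> B z is injective and, in
  finite dimension, onto the dual space. This makes the vector described in
  \<open>christoffel\<close> exist.\<close>

lemma linear_functional_representation:
  fixes B :: "'a::euclidean_space \<Rightarrow> 'a \<Rightarrow> real"
  assumes lin1: "\<And>v. linear (\<lambda>u. B u v)" and lin2: "\<And>u. linear (B u)"
    and pos: "\<And>u. u \<noteq> 0 \<Longrightarrow> 0 < B u u" and f: "linear f"
  shows "\<exists>z. \<forall>w. B z w = f w"
proof -
  define T where "T = (\<lambda>z. \<Sum>b\<in>Basis. B z b *\<^sub>R b)"
  have T: "T z \<bullet> b = B z b" if "b \<in> Basis" for z b
    using that by (simp add: T_def)
  have linT: "linear T"
    unfolding T_def using linear_add[OF lin1] linear_scale[OF lin1]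
    by (intro linearI) (auto simp: scaleR_left_distrib sum.distrib scaleR_sum_right)
  have "inj T"
  proof (subst linear_injective_0[OF linT], intro allI impI)
    fix z assume "T z = 0"
    then have "B z b = 0" if "b \<in> Basis" for b using T[OF that, of z] by simp
    then have "B z z = 0" by (subst linear_eq_sum_Basis[OF lin2]) simp
    with pos[of z] show "z = 0" by force
  qed
  then have "surj T" using linT linear_injective_imp_surjective by blast
  then obtain z where z: "T z = (\<Sum>b\<in>Basis. f b *\<^sub>R b)" by (metis surjD)
  have "B z b = f b" if "b \<in> Basis" for b
    using T[OF that, of z] that by (simp add: z)
  then have "B z w = f w" for w
    by (subst linear_eq_sum_Basis[OF lin2], subst linear_eq_sum_Basis[OF f]) simp
  then show ?thesis by blast
qed

text \<open>The weight \<open>W\<close> allows iteration over the slots of a multilinear expression: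
  the vectors already treated become part of the parameter \<open>s\<close>, and their norms part of
  \<open>W\<close>.\<close>

lemma linear_family_bound:
  fixes f :: "'s \<Rightarrow> 'a::euclidean_space \<Rightarrow> real"
  assumes lin: "\<And>s. s \<in> P \<Longrightarrow> linear (f s)" and W: "\<And>s. s \<in> P \<Longrightarrow> 0 \<le> W s"
    and b: "\<And>b. b \<in> Basis \<Longrightarrow> \<exists>M\<ge>0. \<forall>s\<in>P. \<bar>f s b\<bar> \<le> M * W s"
  shows "\<exists>M\<ge>0. \<forall>s\<in>P. \<forall>u. \<bar>f s u\<bar> \<le> M * W s * norm u"
proof -
  from b obtain M where M: "\<And>b. b \<in> Basis \<Longrightarrow> 0 \<le> M b"
    "\<And>b s. b \<in> Basis \<Longrightarrow> s \<in> P \<Longrightarrow> \<bar>f s b\<bar> \<le> M b * W s"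
    by metis
  show ?thesis
  proof (intro exI conjI ballI allI)
    show "0 \<le> sum M Basis" using M by (simp add: sum_nonneg)
    fix s u assume s: "s \<in> P"
    have "\<bar>f s u\<bar> = \<bar>\<Sum>b\<in>Basis. (u \<bullet> b) * f s b\<bar>"
      by (subst linear_eq_sum_Basis[OF lin[OF s]]) simp
    also have "\<dots> \<le> (\<Sum>b\<in>Basis. \<bar>(u \<bullet> b) * f s b\<bar>)" by (rule sum_abs)
    also have "\<dots> \<le> (\<Sum>b\<in>Basis. norm u * (M b * W s))"
      using M s by (intro sum_mono) (auto simp: abs_mult Basis_le_norm intro!: mult_mono)
    also have "\<dots> = sum M Basis * W s * norm u"
      by (simp add: sum_distrib_left sum_distrib_right mult_ac)
    finally show "\<bar>f s u\<bar> \<le> sum M Basis * W s * norm u" .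
  qed
qed

section \<open>Metrics on open subsets of a Euclidean space\<close>

text \<open>Two derivatives are demanded because the geodesic equation contains the first
  derivatives of the coefficients, and its uniqueness theorem wants these Lipschitz on compact
  convex sets.\<close>

locale coordinate_metric =
  fixes V :: "'e::euclidean_space set" and G :: "'e \<Rightarrow> 'e \<Rightarrow> 'e \<Rightarrow> real"
  assumes open_V: "open V"
    and lin2: "x \<in> V \<Longrightarrow> linear (G x u)"
    and sym: "x \<in> V \<Longrightarrow> G x u v = G x v u"
    and pos: "x \<in> V \<Longrightarrow> u \<noteq> 0 \<Longrightarrow> 0 < G x u u"
    and C2: "Ck_on (Suc (Suc 0)) (\<lambda>x. G x u v) V"
begin

definition DG :: "'e \<Rightarrow> 'e \<Rightarrow> 'e \<Rightarrow> 'e \<Rightarrow> real" where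
  "DG x h u v = frechet_derivative (\<lambda>y. G y u v) (at x) h"

text \<open>The Christoffel symbols of the first kind, contracted with \<open>v, v, w\<close>.\<close>

definition \<Gamma>1 :: "'e \<Rightarrow> 'e \<Rightarrow> 'e \<Rightarrow> real" where
  "\<Gamma>1 x v w = DG x v v w - DG x w v v / 2"

lemma lin1: "x \<in> V \<Longrightarrow> linear (\<lambda>u. G x u v)"
  using lin2 by (simp add: sym[of x _ v])

lemmas G_add2 = linear_add[OF lin2] and G_scale2 = linear_scale[OF lin2, simplified]
  and G_add1 = linear_add[OF lin1]
  and G_scale1 = linear_scale[OF lin1, simplified] and G_diff1 = linear_diff[OF lin1]

lemma has_derivative_G_base:
  "x \<in> V \<Longrightarrow> ((\<lambda>y. G y u v) has_derivative (\<lambda>h. DG x h u v)) (at x)"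
  using Ck_on_open_Suc(1)[OF open_V C2] by (simp add: DG_def)

lemma DG_C1: "Ck_on (Suc 0) (\<lambda>x. DG x h u v) V"
  using Ck_on_open_Suc(2)[OF open_V C2] by (simp add: DG_def)

lemma G_C1: "Ck_on (Suc 0) (\<lambda>x. G x u v) V"
  using C2 by (rule Ck_on_SucD)

lemma lin_DG1: "x \<in> V \<Longrightarrow> linear (\<lambda>h. DG x h u v)"
  using has_derivative_G_base has_derivative_linear by blast

lemma DG_unique:
  "x \<in> V \<Longrightarrow> ((\<lambda>y. G y u v) has_derivative D) (at x) \<Longrightarrow> DG x h u v = D h"
  using has_derivative_G_base has_derivative_unique by metis

lemma DG_sym: "x \<in> V \<Longrightarrow> DG x h u v = DG x h v u"
  by (rule DG_unique, assumption,
      rule has_derivative_transform_within_open[OF has_derivative_G_base open_V]) (auto simp: sym)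

lemma lin_DG3: "x \<in> V \<Longrightarrow> linear (DG x h u)"
proof (rule linearI)
  fix v w :: 'e and r :: real
  assume x: "x \<in> V"
  show "DG x h u (v + w) = DG x h u v + DG x h u w"
    by (rule DG_unique[OF x], rule has_derivative_transform_within_open[OF
          has_derivative_add[OF has_derivative_G_base[OF x] has_derivative_G_base[OF x]] open_V x])
      (simp add: G_add2)
  show "DG x h u (r *\<^sub>R v) = r *\<^sub>R DG x h u v"
    by (rule DG_unique[OF x], rule has_derivative_transform_within_open[OF
          has_derivative_scaleR_right[OF has_derivative_G_base[OF x]] open_V x])
      (simp add: G_scale2)
qed

lemma lin_DG2: "x \<in> V \<Longrightarrow> linear (\<lambda>u. DG x h u v)"
  using lin_DG3 by (simp add: DG_sym[of x h _ v])

lemmas DG_add1 = linear_add[OF lin_DG1] and DG_scale1 = linear_scale[OF lin_DG1, simplified]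
  and DG_diff1 = linear_diff[OF lin_DG1]
  and DG_scale2 = linear_scale[OF lin_DG2, simplified]
  and DG_diff2 = linear_diff[OF lin_DG2]
  and DG_add3 = linear_add[OF lin_DG3] and DG_scale3 = linear_scale[OF lin_DG3, simplified]
  and DG_diff3 = linear_diff[OF lin_DG3]

text \<open>The regularity assumption concerns fixed u and v; this finite sum transfers it to
  vectors that vary with the point.\<close>

lemma G_expand:
  assumes "x \<in> V"
  shows "G x u v = (\<Sum>i\<in>Basis. \<Sum>j\<in>Basis. (u \<bullet> i) * (v \<bullet> j) * G x i j)"
proof -
  have "G x u v = (\<Sum>i\<in>Basis. (u \<bullet> i) *\<^sub>R G x i v)"
    by (rule linear_eq_sum_Basis[OF lin1[OF assms]])
  also have "\<dots> = (\<Sum>i\<in>Basis. (u \<bullet> i) *\<^sub>R (\<Sum>j\<in>Basis. (v \<bullet> j) *\<^sub>R G x i j))"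
    using linear_eq_sum_Basis[OF lin2[OF assms]] by metis
  finally show ?thesis by (simp add: sum_distrib_left mult.assoc)
qed

lemma DG_expand:
  assumes "x \<in> V"
  shows "DG x h u v = (\<Sum>i\<in>Basis. \<Sum>j\<in>Basis. (u \<bullet> i) * (v \<bullet> j) * DG x h i j)"
proof -
  have "DG x h u v = (\<Sum>i\<in>Basis. (u \<bullet> i) *\<^sub>R DG x h i v)"
    by (rule linear_eq_sum_Basis[OF lin_DG2[OF assms]])
  also have "\<dots> = (\<Sum>i\<in>Basis. (u \<bullet> i) *\<^sub>R (\<Sum>j\<in>Basis. (v \<bullet> j) *\<^sub>R DG x h i j))"
    using linear_eq_sum_Basis[OF lin_DG3[OF assms]] by metis
  finally show ?thesis by (simp add: sum_distrib_left mult.assoc)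
qed

lemma has_derivative_G:
  fixes x a b :: "'d::real_normed_vector \<Rightarrow> 'e"
  assumes x: "(x has_derivative x') (at t within S)" and a: "(a has_derivative a') (at t within S)"
    and b: "(b has_derivative b') (at t within S)" and t: "t \<in> S" and V: "\<And>s. s \<in> S \<Longrightarrow> x s \<in> V"
  shows "((\<lambda>s. G (x s) (a s) (b s)) has_derivative
    (\<lambda>h. DG (x t) (x' h) (a t) (b t) + G (x t) (a' h) (b t) + G (x t) (a t) (b' h))) (at t within S)"
proof -
  have xt: "x t \<in> V" using t V by blast
  have Gx: "((\<lambda>s. G (x s) u v) has_derivative (\<lambda>h. DG (x t) (x' h) u v)) (at t within S)" for u v
    using diff_chain_within[OF x has_derivative_at_withinI[OF has_derivative_G_base[OF xt]]]
    by (simp add: o_def)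
  have ai: "((\<lambda>s. a s \<bullet> i) has_derivative (\<lambda>h. a' h \<bullet> i)) (at t within S)" for i
    using a by (rule has_derivative_inner_left)
  have bi: "((\<lambda>s. b s \<bullet> i) has_derivative (\<lambda>h. b' h \<bullet> i)) (at t within S)" for i
    using b by (rule has_derivative_inner_left)
  have "((\<lambda>s. \<Sum>i\<in>Basis. \<Sum>j\<in>Basis. (a s \<bullet> i) * (b s \<bullet> j) * G (x s) i j) has_derivative
      (\<lambda>h. \<Sum>i\<in>Basis. \<Sum>j\<in>Basis. (a t \<bullet> i) * (b t \<bullet> j) * DG (x t) (x' h) i j +
        ((a t \<bullet> i) * (b' h \<bullet> j) + (a' h \<bullet> i) * (b t \<bullet> j)) * G (x t) i j)) (at t within S)"
    by (intro has_derivative_sum has_derivative_mult Gx ai bi)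
  also have "(\<lambda>h. \<Sum>i\<in>Basis. \<Sum>j\<in>Basis. (a t \<bullet> i) * (b t \<bullet> j) * DG (x t) (x' h) i j +
        ((a t \<bullet> i) * (b' h \<bullet> j) + (a' h \<bullet> i) * (b t \<bullet> j)) * G (x t) i j) =
      (\<lambda>h. DG (x t) (x' h) (a t) (b t) + G (x t) (a' h) (b t) + G (x t) (a t) (b' h))"
  proof (rule ext)
    fix h
    show "(\<Sum>i\<in>Basis. \<Sum>j\<in>Basis. (a t \<bullet> i) * (b t \<bullet> j) * DG (x t) (x' h) i j +
        ((a t \<bullet> i) * (b' h \<bullet> j) + (a' h \<bullet> i) * (b t \<bullet> j)) * G (x t) i j) =
      DG (x t) (x' h) (a t) (b t) + G (x t) (a' h) (b t) + G (x t) (a t) (b' h)"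
      unfolding DG_expand[OF xt, of "x' h" "a t" "b t"] G_expand[OF xt, of "a' h" "b t"]
        G_expand[OF xt, of "a t" "b' h"] sum.distrib[symmetric]
      by (intro sum.cong refl) (simp add: algebra_simps)
  qed
  finally show ?thesis
    by (rule has_derivative_transform[rotated 2]) (rule t, rule G_expand, rule V)
qed

lemma has_vector_derivative_G:
  fixes x a b :: "real \<Rightarrow> 'e"
  assumes "(x has_vector_derivative x') (at t within S)" "(a has_vector_derivative a') (at t within S)"
    "(b has_vector_derivative b') (at t within S)" "t \<in> S" "\<And>s. s \<in> S \<Longrightarrow> x s \<in> V"
  shows "((\<lambda>s. G (x s) (a s) (b s)) has_real_derivative
    DG (x t) x' (a t) (b t) + G (x t) a' (b t) + G (x t) (a t) b') (at t within S)"
proof -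
  have xt: "x t \<in> V" using assms by blast
  have "(\<lambda>h. DG (x t) (h *\<^sub>R x') (a t) (b t) + G (x t) (h *\<^sub>R a') (b t) + G (x t) (a t) (h *\<^sub>R b')) =
      (*) (DG (x t) x' (a t) (b t) + G (x t) a' (b t) + G (x t) (a t) b')"
    by (rule ext) (simp add: DG_scale1[OF xt] G_scale1[OF xt] G_scale2[OF xt] algebra_simps)
  then show ?thesis
    using has_derivative_G[OF assms(1-3)[unfolded has_vector_derivative_def] assms(4,5)]
    by (simp add: has_field_derivative_def)
qed

section \<open>Estimates on compact sets\<close>

text \<open>On \<open>K\<close> times the unit sphere the positive continuous function G x u u
  attains a positive minimum; homogeneity of degree two extends the bound to all u.\<close>

lemma G_coercive:
  assumes "compact K" "K \<subseteq> V"
  obtains c where "0 < c" "\<And>x u. x \<in> K \<Longrightarrow> c * (norm u)\<^sup>2 \<le> G x u u"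
proof (cases "K = {}")
  case True
  then show ?thesis using that[of 1] by simp
next
  case False
  obtain b :: 'e where "b \<in> Basis" using nonempty_Basis by blast
  then have ne: "K \<times> sphere (0::'e) 1 \<noteq> {}"
    using False norm_Basis by (auto simp: dist_norm intro: exI[of _ b])
  have cont: "continuous_on (K \<times> sphere 0 1) (\<lambda>q. G (fst q) (snd q) (snd q))"
  proof -
    have 1: "continuous_on (K \<times> sphere 0 1) (\<lambda>q. G (fst q) i j)" for i j
      by (rule continuous_on_compose2[OF continuous_on_subset[OF Ck_on_imp_continuous_on[OF C2] assms(2)]])
        (auto intro!: continuous_intros)
    have "continuous_on (K \<times> sphere 0 1) (\<lambda>q. \<Sum>i\<in>Basis. \<Sum>j\<in>Basis.
        (snd q \<bullet> i) * (snd q \<bullet> j) * G (fst q) i j)"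
      by (intro continuous_intros 1)
    then show ?thesis
      by (rule continuous_on_cong[THEN iffD1, rotated 2]) (use assms in \<open>auto intro!: G_expand[symmetric] dest: subsetD\<close>)
  qed
  have "compact (K \<times> sphere (0::'e) 1)"
    by (intro compact_Times assms compact_sphere)
  from continuous_attains_inf[OF this ne cont] obtain x0 u0 where
    0: "x0 \<in> K" "norm u0 = 1" and min: "\<And>x u. x \<in> K \<Longrightarrow> norm u = 1 \<Longrightarrow> G x0 u0 u0 \<le> G x u u"
    by auto
  show ?thesis
  proof
    show "0 < G x0 u0 u0" using 0 assms by (intro pos) auto
    fix x u assume x: "x \<in> K"
    then have xV: "x \<in> V" using assms by blast
    show "G x0 u0 u0 * (norm u)\<^sup>2 \<le> G x u u"
    proof (cases "u = 0")
      case True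
      then show ?thesis using linear_0[OF lin2[OF xV]] by simp
    next
      case False
      have "G x0 u0 u0 \<le> G x (inverse (norm u) *\<^sub>R u) (inverse (norm u) *\<^sub>R u)"
        using False by (intro min x) simp
      also have "\<dots> = G x u u / (norm u)\<^sup>2"
        by (simp add: G_scale1[OF xV] G_scale2[OF xV] power2_eq_square field_simps)
      finally show ?thesis using False by (simp add: field_simps)
    qed
  qed
qed

text \<open>Continuity gives a bound for each fixed triple of vectors. Three applications of
  \<open>linear_family_bound\<close> make it uniform, one slot at a time.\<close>

lemma DG_bound:
  assumes "compact K" "K \<subseteq> V"
  shows "\<exists>M\<ge>0. \<forall>x\<in>K. \<forall>h u v. \<bar>DG x h u v\<bar> \<le> M * (norm h * norm u * norm v)"
proof -
  have 1: "\<exists>M\<ge>0. \<forall>x\<in>K. \<bar>DG x h u v\<bar> \<le> M * 1" for h u v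
  proof -
    have "compact ((\<lambda>x. DG x h u v) ` K)"
      using Ck_on_imp_continuous_on[OF DG_C1] assms by (meson compact_continuous_image continuous_on_subset)
    then obtain M where "\<And>x. x \<in> K \<Longrightarrow> \<bar>DG x h u v\<bar> \<le> M"
      using compact_imp_bounded bounded_iff by (metis image_eqI real_norm_def)
    then show ?thesis by (intro exI[of _ "\<bar>M\<bar>"]) force
  qed
  have 2: "\<exists>M\<ge>0. \<forall>x\<in>K. \<forall>h. \<bar>DG x h u v\<bar> \<le> M * 1 * norm h" for u v
    using assms by (intro linear_family_bound[where f="\<lambda>x h. DG x h u v"] lin_DG1 1) auto
  have 3: "\<exists>M\<ge>0. \<forall>s\<in>K \<times> UNIV. \<forall>u. \<bar>DG (fst s) (snd s) u v\<bar> \<le> M * norm (snd s) * norm u" for v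
    using assms 2[of _ v]
    by (intro linear_family_bound[where f="\<lambda>s u. DG (fst s) (snd s) u v"] lin_DG2) auto
  have "\<exists>M\<ge>0. \<forall>s\<in>K \<times> UNIV \<times> UNIV. \<forall>v. \<bar>DG (fst s) (fst (snd s)) (snd (snd s)) v\<bar> \<le>
      M * (norm (fst (snd s)) * norm (snd (snd s))) * norm v"
    using assms 3
    by (intro linear_family_bound[where f="\<lambda>s. DG (fst s) (fst (snd s)) (snd (snd s))"] lin_DG3)
      (auto simp: mult.assoc)
  then show ?thesis by (auto simp: mult.assoc)
qed

lemma DG_lipschitz:
  assumes "compact K" "convex K" "K \<subseteq> V"
  shows "\<exists>L\<ge>0. \<forall>x\<in>K. \<forall>y\<in>K. \<forall>h u v.
    \<bar>DG x h u v - DG y h u v\<bar> \<le> L * (norm (x - y) * norm h * norm u * norm v)"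
proof -
  \<comment> \<open>For a Lipschitz bound the parameter is a pair of points and the initial weight
    is their distance; the slotwise argument is that of \<open>DG_bound\<close>.\<close>
  define f where "f = (\<lambda>q h u v. DG (fst q) h u v - DG (snd q) h u v)"
  define W where "W = (\<lambda>q. norm (fst q - snd q :: 'e))"
  have W: "0 \<le> W q" for q by (simp add: W_def)
  have lin: "linear (\<lambda>h. f q h u v)" "linear (\<lambda>u. f q h u v)" "linear (f q h u)"
    if "q \<in> K \<times> K" for q h u v
    unfolding f_def using that assms(3)
    by (auto intro!: linear_compose_sub lin_DG1 lin_DG2 lin_DG3)
  have 1: "\<exists>M\<ge>0. \<forall>q\<in>K \<times> K. \<bar>f q h u v\<bar> \<le> M * W q" for h u v
    by (rule Ck_on_imp_lipschitz[OF open_V DG_C1[of h u v] assms]) (auto simp: f_def W_def)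
  have 2: "\<exists>M\<ge>0. \<forall>q\<in>K \<times> K. \<forall>h. \<bar>f q h u v\<bar> \<le> M * W q * norm h" for u v
    using 1 W by (intro linear_family_bound[where f="\<lambda>q h. f q h u v"] lin) auto
  have 3: "\<exists>M\<ge>0. \<forall>s\<in>(K \<times> K) \<times> UNIV. \<forall>u. \<bar>f (fst s) (snd s) u v\<bar> \<le> M * (W (fst s) * norm (snd s)) * norm u" for v
    using 2[of _ v] W
    by (intro linear_family_bound[where f="\<lambda>s u. f (fst s) (snd s) u v"] lin) (auto simp: mult.assoc)
  have "\<exists>M\<ge>0. \<forall>s\<in>(K \<times> K) \<times> UNIV \<times> UNIV. \<forall>v. \<bar>f (fst s) (fst (snd s)) (snd (snd s)) v\<bar> \<le>
      M * (W (fst s) * norm (fst (snd s)) * norm (snd (snd s))) * norm v"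
    using 3 W
    by (intro linear_family_bound[where f="\<lambda>s. f (fst s) (fst (snd s)) (snd (snd s))"] lin)
      (auto simp: mult.assoc)
  then show ?thesis by (auto simp: mult.assoc f_def W_def)
qed

lemma G_lipschitz:
  assumes "compact K" "convex K" "K \<subseteq> V"
  shows "\<exists>L\<ge>0. \<forall>x\<in>K. \<forall>y\<in>K. \<forall>u v.
    \<bar>G x u v - G y u v\<bar> \<le> L * (norm (x - y) * norm u * norm v)"
proof -
  define f where "f = (\<lambda>q u v. G (fst q) u v - G (snd q) u v)"
  define W where "W = (\<lambda>q. norm (fst q - snd q :: 'e))"
  have W: "0 \<le> W q" for q by (simp add: W_def)
  have lin: "linear (\<lambda>u. f q u v)" "linear (f q u)" if "q \<in> K \<times> K" for q u v
    unfolding f_def using that assms(3)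
    by (auto intro!: linear_compose_sub lin1 lin2)
  have 1: "\<exists>M\<ge>0. \<forall>q\<in>K \<times> K. \<bar>f q u v\<bar> \<le> M * W q" for u v
    by (rule Ck_on_imp_lipschitz[OF open_V G_C1[of u v] assms]) (auto simp: f_def W_def)
  have 2: "\<exists>M\<ge>0. \<forall>q\<in>K \<times> K. \<forall>u. \<bar>f q u v\<bar> \<le> M * W q * norm u" for v
    using 1 W by (intro linear_family_bound[where f="\<lambda>q u. f q u v"] lin) auto
  have "\<exists>M\<ge>0. \<forall>s\<in>(K \<times> K) \<times> UNIV. \<forall>v. \<bar>f (fst s) (snd s) v\<bar> \<le> M * (W (fst s) * norm (snd s)) * norm v"
    using 2 W
    by (intro linear_family_bound[where f="\<lambda>s. f (fst s) (snd s)"] lin) (auto simp: mult.assoc)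
  then show ?thesis by (auto simp: mult.assoc f_def W_def)
qed

text \<open>The difference splits into a change of base point at fixed velocity, controlled by
  \<open>L\<close>, and a change of velocity, controlled by \<open>M\<close> because \<Gamma>1 is
  quadratic in it.\<close>

lemma \<Gamma>1_bounds:
  assumes K: "compact K" "convex K" "K \<subseteq> V"
  obtains M L where "0 \<le> M" "0 \<le> L"
    "\<And>x v w. x \<in> K \<Longrightarrow> \<bar>\<Gamma>1 x v w\<bar> \<le> M * (norm v)\<^sup>2 * norm w"
    "\<And>x y u v w N. x \<in> K \<Longrightarrow> y \<in> K \<Longrightarrow> norm u \<le> N \<Longrightarrow> norm v \<le> N \<Longrightarrow>
      \<bar>\<Gamma>1 x u w - \<Gamma>1 y v w\<bar> \<le> (L * N\<^sup>2 * norm (x - y) + M * N * norm (u - v)) * norm w"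
proof -
  obtain M where M: "0 \<le> M" "\<And>x h u v. x \<in> K \<Longrightarrow> \<bar>DG x h u v\<bar> \<le> M * (norm h * norm u * norm v)"
    using DG_bound[OF K(1,3)] by metis
  obtain L where L: "0 \<le> L" "\<And>x y h u v. x \<in> K \<Longrightarrow> y \<in> K \<Longrightarrow>
      \<bar>DG x h u v - DG y h u v\<bar> \<le> L * (norm (x - y) * norm h * norm u * norm v)"
    using DG_lipschitz[OF K] by metis
  have 1: "\<bar>\<Gamma>1 x v w\<bar> \<le> (3 * M) * (norm v)\<^sup>2 * norm w" if x: "x \<in> K" for x v w
  proof -
    have "\<bar>DG x v v w\<bar> \<le> M * (norm v)\<^sup>2 * norm w"
      using M(2)[OF x, of v v w] by (simp add: power2_eq_square mult_ac)
    moreover have "\<bar>DG x w v v\<bar> \<le> M * (norm v)\<^sup>2 * norm w"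
      using M(2)[OF x, of w v v] by (simp add: power2_eq_square mult_ac)
    moreover have "0 \<le> M * (norm v)\<^sup>2 * norm w" using M by simp
    ultimately show ?thesis unfolding \<Gamma>1_def by (simp add: abs_if split: if_splits)
  qed
  have 2: "\<bar>\<Gamma>1 x u w - \<Gamma>1 y v w\<bar> \<le> (2 * L * N\<^sup>2 * norm (x - y) + (3 * M) * N * norm (u - v)) * norm w"
    if x: "x \<in> K" and y: "y \<in> K" and N: "norm u \<le> N" "norm v \<le> N" for x y u v w N
  proof -
    have yV: "y \<in> V" using y K by blast
    have N0: "0 \<le> N" using N norm_ge_zero order_trans by blast
    have uu: "norm u * norm u \<le> N\<^sup>2"
      using N N0 by (simp add: power2_eq_square mult_mono)
    let ?A = "L * N\<^sup>2 * norm (x - y) * norm w" and ?B = "M * N * norm (u - v) * norm w"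
    have a: "\<bar>DG x u u w - DG y u u w\<bar> \<le> ?A"
    proof -
      have "L * (norm (x - y) * norm u * norm u * norm w) = (L * norm (x - y) * norm w) * (norm u * norm u)"
        by (simp add: mult_ac)
      also have "\<dots> \<le> (L * norm (x - y) * norm w) * N\<^sup>2"
        using L uu by (intro mult_left_mono) auto
      finally show ?thesis using L(2)[OF x y, of u u w] by (simp add: mult_ac)
    qed
    have b: "\<bar>DG x w u u - DG y w u u\<bar> \<le> ?A"
    proof -
      have "L * (norm (x - y) * norm w * norm u * norm u) = (L * norm (x - y) * norm w) * (norm u * norm u)"
        by (simp add: mult_ac)
      also have "\<dots> \<le> (L * norm (x - y) * norm w) * N\<^sup>2"
        using L uu by (intro mult_left_mono) auto
      finally show ?thesis using L(2)[OF x y, of w u u] by (simp add: mult_ac)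
    qed
    have MB: "(M * norm (u - v) * norm w) * n \<le> ?B" if "n \<le> N" for n
    proof -
      have "(M * norm (u - v) * norm w) * n \<le> (M * norm (u - v) * norm w) * N"
        using M that by (intro mult_left_mono) auto
      then show ?thesis by (simp add: mult_ac)
    qed
    have c: "\<bar>DG y (u - v) u w\<bar> \<le> ?B" "\<bar>DG y v (u - v) w\<bar> \<le> ?B"
      "\<bar>DG y w (u - v) u\<bar> \<le> ?B" "\<bar>DG y w v (u - v)\<bar> \<le> ?B"
      using M(2)[OF y, of "u - v" u w] M(2)[OF y, of v "u - v" w]
        M(2)[OF y, of w "u - v" u] M(2)[OF y, of w v "u - v"] MB[OF N(1)] MB[OF N(2)]
      by (simp_all add: mult_ac)
    have "\<Gamma>1 x u w - \<Gamma>1 y v w = (DG x u u w - DG y u u w) + DG y (u - v) u w + DG y v (u - v) w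
        - ((DG x w u u - DG y w u u) + DG y w (u - v) u + DG y w v (u - v)) / 2"
      unfolding \<Gamma>1_def using yV
      by (simp add: DG_diff1 DG_diff2 DG_diff3 field_simps)
    \<comment> \<open>The base point terms add up to 3/2 A, rounded up to 2 A, and the velocity
      terms to 3 B; this is the origin of the factors of \<open>L\<close> and
      \<open>M\<close>.\<close>
    moreover have "\<bar>p + q + r - (s + t + z) / 2\<bar> \<le> 2 * A + 3 * B"
      if "\<bar>p\<bar> \<le> A" "\<bar>s\<bar> \<le> A" "\<bar>q\<bar> \<le> B" "\<bar>r\<bar> \<le> B" "\<bar>t\<bar> \<le> B" "\<bar>z\<bar> \<le> B" for p q r s t z A B :: real
      using that by (intro abs_leI) (simp_all add: abs_le_iff field_simps)
    ultimately have "\<bar>\<Gamma>1 x u w - \<Gamma>1 y v w\<bar> \<le> 2 * ?A + 3 * ?B"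
      using a b c by presburger
    then show ?thesis by (simp add: algebra_simps)
  qed
  show thesis
    using that[of "3 * M" "2 * L", OF _ _ 1 2] M(1) L(1) by simp
qed

section \<open>Uniqueness for the geodesic equation\<close>

text \<open>The equation is of second order, so Gronwall is applied to the squared distance of the
  pairs (position, velocity). Accelerations are known only through their products with test vectors;
  testing with their difference and coercivity bound this difference by the distance of the
  pairs.\<close>

lemma geodesic_equation_unique:
  fixes x x1 x2 y y1 y2 :: "real \<Rightarrow> 'e"
  assumes K: "compact K" "convex K" "K \<subseteq> V"
    and x: "\<And>t. t \<in> {a..b} \<Longrightarrow> (x has_vector_derivative x1 t) (at t within {a..b})"
    and x1: "\<And>t. t \<in> {a..b} \<Longrightarrow> (x1 has_vector_derivative x2 t) (at t within {a..b})"
    and gx: "\<And>t w. t \<in> {a..b} \<Longrightarrow> G (x t) (x2 t) w = - \<Gamma>1 (x t) (x1 t) w"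
    and xK: "\<And>t. t \<in> {a..b} \<Longrightarrow> x t \<in> K"
    and y: "\<And>t. t \<in> {a..b} \<Longrightarrow> (y has_vector_derivative y1 t) (at t within {a..b})"
    and y1: "\<And>t. t \<in> {a..b} \<Longrightarrow> (y1 has_vector_derivative y2 t) (at t within {a..b})"
    and gy: "\<And>t w. t \<in> {a..b} \<Longrightarrow> G (y t) (y2 t) w = - \<Gamma>1 (y t) (y1 t) w"
    and yK: "\<And>t. t \<in> {a..b} \<Longrightarrow> y t \<in> K"
    and init: "x a = y a" "x1 a = y1 a" and t: "t \<in> {a..b}"
  shows "x t = y t"
proof -
  obtain M L where M: "0 \<le> M" and L: "0 \<le> L" and
    bd: "\<And>x v w. x \<in> K \<Longrightarrow> \<bar>\<Gamma>1 x v w\<bar> \<le> M * (norm v)\<^sup>2 * norm w" and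
    lip: "\<And>x y u v w N. x \<in> K \<Longrightarrow> y \<in> K \<Longrightarrow> norm u \<le> N \<Longrightarrow> norm v \<le> N \<Longrightarrow>
      \<bar>\<Gamma>1 x u w - \<Gamma>1 y v w\<bar> \<le> (L * N\<^sup>2 * norm (x - y) + M * N * norm (u - v)) * norm w"
    using \<Gamma>1_bounds[OF K] by metis
  obtain c where c: "0 < c" "\<And>x u. x \<in> K \<Longrightarrow> c * (norm u)\<^sup>2 \<le> G x u u"
    using G_coercive[OF K(1,3)] by metis
  obtain P where P: "0 \<le> P" "\<And>x y u v. x \<in> K \<Longrightarrow> y \<in> K \<Longrightarrow>
      \<bar>G x u v - G y u v\<bar> \<le> P * (norm (x - y) * norm u * norm v)"
    using G_lipschitz[OF K] by metis
  have "\<exists>N. \<forall>t\<in>{a..b}. norm (f t) \<le> N"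
    if "\<And>t. t \<in> {a..b} \<Longrightarrow> (f has_vector_derivative f' t) (at t within {a..b})" for f f' :: "real \<Rightarrow> 'e"
  proof -
    have "continuous_on {a..b} f"
      using that continuous_on_vector_derivative by blast
    then have "bounded (f ` {a..b})"
      using compact_continuous_image compact_imp_bounded compact_Icc by blast
    then show ?thesis by (auto simp: bounded_iff)
  qed
  from this[OF x1] this[OF y1] obtain N1 N2
    where N12: "\<forall>t\<in>{a..b}. norm (x1 t) \<le> N1" "\<forall>t\<in>{a..b}. norm (y1 t) \<le> N2"
    by blast
  define N where "N = max N1 N2"
  have Nx: "norm (x1 t) \<le> N" and Ny: "norm (y1 t) \<le> N" if "t \<in> {a..b}" for t
    using N12 that by (auto simp: N_def le_max_iff_disj)
  have N0: "0 \<le> N" using Nx[OF t] norm_ge_zero order_trans by blast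
  have cancel: "c * norm z \<le> B" if "c * (norm z)\<^sup>2 \<le> B * norm z" "0 \<le> B" for z :: 'e and B
    using that by (cases "z = 0") (simp_all add: power2_eq_square)
  \<comment> \<open>The two equations are tested in the different metrics \<open>G (x t)\<close> and
    \<open>G (y t)\<close>. Replacing one by the other costs an error proportional to
    \<open>y2\<close>, so a bound for this acceleration is needed.\<close>
  define Y where "Y = M * N\<^sup>2 / c"
  have Y: "norm (y2 t) \<le> Y" if t: "t \<in> {a..b}" for t
  proof -
    have "c * (norm (y2 t))\<^sup>2 \<le> \<bar>\<Gamma>1 (y t) (y1 t) (y2 t)\<bar>"
      using c(2)[OF yK[OF t], of "y2 t"] gy[OF t, of "y2 t"] by linarith
    also have "\<dots> \<le> M * (norm (y1 t))\<^sup>2 * norm (y2 t)"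
      by (rule bd[OF yK[OF t]])
    also have "\<dots> \<le> (M * N\<^sup>2) * norm (y2 t)"
      using Ny[OF t] M by (intro mult_right_mono mult_left_mono power_mono) auto
    finally have "c * norm (y2 t) \<le> M * N\<^sup>2"
      by (rule cancel) (use M in simp)
    then show ?thesis using c by (simp add: Y_def field_simps)
  qed
  have Y0: "0 \<le> Y" using M c by (simp add: Y_def)
  define C where "C = (L * N\<^sup>2 + M * N + P * Y) / c"
  have C0: "0 \<le> C" using L M N0 P Y0 c by (simp add: C_def)
  have key: "norm (x2 t - y2 t) \<le> C * (norm (x t - y t) + norm (x1 t - y1 t))" if t: "t \<in> {a..b}" for t
  proof -
    let ?z = "norm (x t - y t)" and ?z1 = "norm (x1 t - y1 t)" and ?w = "x2 t - y2 t"
    have xV: "x t \<in> V" using xK[OF t] K by blast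
    have "c * (norm ?w)\<^sup>2 \<le> G (x t) ?w ?w" by (rule c(2)[OF xK[OF t]])
    also have "\<dots> = - (\<Gamma>1 (x t) (x1 t) ?w - \<Gamma>1 (y t) (y1 t) ?w) - (G (x t) (y2 t) ?w - G (y t) (y2 t) ?w)"
      using gx[OF t] gy[OF t] by (simp add: G_diff1[OF xV])
    also have "\<dots> \<le> (L * N\<^sup>2 * ?z + M * N * ?z1) * norm ?w + P * (?z * norm (y2 t) * norm ?w)"
      using lip[OF xK[OF t] yK[OF t] Nx[OF t] Ny[OF t], of ?w] P(2)[OF xK[OF t] yK[OF t], of "y2 t" ?w]
      by linarith
    also have "\<dots> \<le> (L * N\<^sup>2 * ?z + M * N * ?z1) * norm ?w + P * (?z * Y * norm ?w)"
      using Y[OF t] P by (intro add_left_mono mult_left_mono mult_right_mono) auto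
    also have "\<dots> = (L * N\<^sup>2 * ?z + M * N * ?z1 + P * Y * ?z) * norm ?w"
      by (simp add: algebra_simps)
    finally have "c * norm ?w \<le> L * N\<^sup>2 * ?z + M * N * ?z1 + P * Y * ?z"
      by (rule cancel) (use L M N0 P Y0 in simp)
    also have "\<dots> \<le> (L * N\<^sup>2 + M * N + P * Y) * (?z + ?z1)"
    proof -
      have "0 \<le> L * N\<^sup>2 * ?z1" "0 \<le> M * N * ?z" "0 \<le> P * Y * ?z1"
        using L M N0 P Y0 by auto
      then show ?thesis by (simp add: algebra_simps)
    qed
    finally show ?thesis using c by (simp add: C_def field_simps)
  qed
  define \<phi> where "\<phi> = (\<lambda>t. (x t - y t) \<bullet> (x t - y t) + (x1 t - y1 t) \<bullet> (x1 t - y1 t))"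
  \<comment> \<open>In the constant 1 + 3 * C the 1 comes from 2 z.z1, and 3 * C from 2 z1.z2, by
    \<open>key\<close> and 2ab \<le> a^2 + b^2.\<close>
  have "\<phi> t \<le> 0"
  proof (rule gronwall_zero[where \<phi>=\<phi> and t=t and a=a and b=b and C="1 + 3 * C" and
        \<phi>'="\<lambda>t. 2 * ((x t - y t) \<bullet> (x1 t - y1 t)) + 2 * ((x1 t - y1 t) \<bullet> (x2 t - y2 t))"])
    fix t assume t: "t \<in> {a..b}"
    let ?z = "x t - y t" and ?z1 = "x1 t - y1 t" and ?z2 = "x2 t - y2 t"
    show "(\<phi> has_real_derivative 2 * (?z \<bullet> ?z1) + 2 * (?z1 \<bullet> ?z2)) (at t within {a..b})"
      unfolding \<phi>_def has_field_derivative_def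
      by (rule derivative_eq_intros x[OF t, unfolded has_vector_derivative_def]
          y[OF t, unfolded has_vector_derivative_def] x1[OF t, unfolded has_vector_derivative_def]
          y1[OF t, unfolded has_vector_derivative_def] refl)+
        (auto simp: fun_eq_iff inner_diff_left inner_diff_right inner_commute algebra_simps)
    have "?z \<bullet> ?z1 \<le> norm ?z * norm ?z1" "?z1 \<bullet> ?z2 \<le> norm ?z1 * norm ?z2"
      by (rule norm_cauchy_schwarz)+
    moreover have "norm ?z1 * norm ?z2 \<le> norm ?z1 * (C * (norm ?z + norm ?z1))"
      by (rule mult_left_mono[OF key[OF t]]) simp
    moreover have am: "2 * (norm ?z * norm ?z1) \<le> (norm ?z)\<^sup>2 + (norm ?z1)\<^sup>2"
      using sum_squares_bound[of "norm ?z" "norm ?z1"] by simp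
    moreover have "C * (2 * (norm ?z * norm ?z1)) \<le> C * ((norm ?z)\<^sup>2 + (norm ?z1)\<^sup>2)"
      by (rule mult_left_mono[OF am C0])
    moreover have "0 \<le> C * (norm ?z)\<^sup>2" using C0 by simp
    ultimately have "2 * (?z \<bullet> ?z1) + 2 * (?z1 \<bullet> ?z2) \<le> (1 + 3 * C) * ((norm ?z)\<^sup>2 + (norm ?z1)\<^sup>2)"
      by (simp add: algebra_simps power2_eq_square)
    then show "2 * (?z \<bullet> ?z1) + 2 * (?z1 \<bullet> ?z2) \<le> (1 + 3 * C) * \<phi> t"
      by (simp add: \<phi>_def power2_norm_eq_inner)
  qed (use init t in \<open>auto simp: \<phi>_def\<close>)
  then have "(x t - y t) \<bullet> (x t - y t) \<le> 0"
    unfolding \<phi>_def using inner_ge_zero[of "x1 t - y1 t"] by linarith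
  then show ?thesis by (metis inner_gt_zero_iff eq_iff_diff_eq_0 not_less)
qed

section \<open>The Gauss lemma\<close>

text \<open>
  Along a radial geodesic, \<open>G(x', x')\<close> is constant, and \<open>G(x', J)\<close> for the variation field \<open>J\<close> has
  the derivative of the energy in the direction of the variation as its derivative.
\<close>

lemma gauss_lemma:
  fixes \<Phi> :: "'e \<Rightarrow> 'e"
  defines "D \<equiv> \<lambda>x v. frechet_derivative \<Phi> (at x) v"
  assumes U: "open U" and star: "\<And>w t. w \<in> U \<Longrightarrow> t \<in> {0..1} \<Longrightarrow> t *\<^sub>R w \<in> U"
    and \<Phi>C2: "Ck_on (Suc (Suc 0)) \<Phi> U" and \<Phi>V: "\<And>w. w \<in> U \<Longrightarrow> \<Phi> w \<in> V"
    and D0: "\<And>w. w \<in> U \<Longrightarrow> D 0 w = w"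
    and geo: "\<And>w t z. w \<in> U \<Longrightarrow> t \<in> {0..1} \<Longrightarrow>
      G (\<Phi> (t *\<^sub>R w)) (frechet_derivative (\<lambda>x. D x w) (at (t *\<^sub>R w)) w) z = - \<Gamma>1 (\<Phi> (t *\<^sub>R w)) (D (t *\<^sub>R w) w) z"
    and w: "w \<in> U"
  shows "G (\<Phi> w) (D w u) (D w w) = G (\<Phi> 0) u w"
proof -
  define DD where "DD = (\<lambda>v x h. frechet_derivative (\<lambda>x. D x v) (at x) h)"
  have d1: "(\<Phi> has_derivative D x) (at x)" if "x \<in> U" for x
    using Ck_on_open_Suc(1)[OF U \<Phi>C2 that] by (simp add: D_def)
  have DC: "Ck_on (Suc 0) (\<lambda>x. D x v) U" for v
    using Ck_on_open_Suc(2)[OF U \<Phi>C2] by (simp add: D_def)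
  have d2: "((\<lambda>x. D x v) has_derivative DD v x) (at x)" if "x \<in> U" for x v
    using Ck_on_open_Suc(1)[OF U DC that] by (simp add: DD_def)
  have DD_sym: "DD v x h = DD h x v" if "x \<in> U" for x v h
    using frechet_derivative_symmetric[OF U \<Phi>C2 that] by (simp add: DD_def D_def)
  have ray: "((\<lambda>t. t *\<^sub>R w) has_vector_derivative w) (at t within S)" for w :: 'e and t S
    by (auto intro!: derivative_eq_intros)
  have zU: "0 \<in> U" using star[OF w, of 0] by simp
  have x1: "((\<lambda>t. \<Phi> (t *\<^sub>R w)) has_vector_derivative D (t *\<^sub>R w) w) (at t within {0..1})"
    if "w \<in> U" "t \<in> {0..1}" for w t
    by (rule has_vector_derivative_chain[OF d1[OF star[OF that]] ray])
  have x2: "((\<lambda>t. D (t *\<^sub>R w) v) has_vector_derivative DD v (t *\<^sub>R w) w) (at t within {0..1})"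
    if "w \<in> U" "t \<in> {0..1}" for w t v
    by (rule has_vector_derivative_chain[OF d2[OF star[OF that]] ray])
  have geo': "G (\<Phi> (t *\<^sub>R w)) (DD w (t *\<^sub>R w) w) z = - \<Gamma>1 (\<Phi> (t *\<^sub>R w)) (D (t *\<^sub>R w) w) z"
    if "w \<in> U" "t \<in> {0..1}" for w t z
    using geo[OF that] by (simp add: DD_def)
  \<comment> \<open>\<open>geo'\<close> tested with the velocity v cancels the derivative of the
    coefficients, as \<Gamma>1 x v v is half of \<open>DG x v v v\<close>. At t = 0 the velocity is
    \<open>w\<close> by \<open>D0\<close>.\<close>
  have energy: "G (\<Phi> (t *\<^sub>R w)) (D (t *\<^sub>R w) w) (D (t *\<^sub>R w) w) = G (\<Phi> 0) w w"
    if w: "w \<in> U" and t: "t \<in> {0..1}" for w t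
  proof -
    have "((\<lambda>t. G (\<Phi> (t *\<^sub>R w)) (D (t *\<^sub>R w) w) (D (t *\<^sub>R w) w)) has_real_derivative 0) (at t within {0..1})"
      if t: "t \<in> {0..1}" for t
    proof -
      have xV: "\<Phi> (t *\<^sub>R w) \<in> V" using \<Phi>V star w t by blast
      show ?thesis
        by (rule DERIV_cong[OF has_vector_derivative_G[OF x1[OF w t] x2[OF w t] x2[OF w t] t]])
          (use \<Phi>V star w geo'[OF w t, of "D (t *\<^sub>R w) w"] in
            \<open>auto simp: sym[OF xV, of _ "DD w (t *\<^sub>R w) w"] \<Gamma>1_def\<close>)
    qed
    from has_field_derivative_zero_constant[OF _ this] obtain c
      where c: "\<And>t. t \<in> {0..1} \<Longrightarrow> G (\<Phi> (t *\<^sub>R w)) (D (t *\<^sub>R w) w) (D (t *\<^sub>R w) w) = c"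
      by auto
    show ?thesis using c[OF t] c[of 0] D0[OF w] by simp
  qed
  \<comment> \<open>\<open>J t\<close> is the derivative of \<Phi>(t (w + s u)) at s = 0, and
    \<open>J' t\<close> is the derivative of \<open>J\<close> in t.\<close>
  define J where "J = (\<lambda>t. t *\<^sub>R D (t *\<^sub>R w) u)"
  define J' where "J' = (\<lambda>t. D (t *\<^sub>R w) u + t *\<^sub>R DD u (t *\<^sub>R w) w)"
  have Jd: "(J has_vector_derivative J' t) (at t within {0..1})" if "t \<in> {0..1}" for t
    unfolding J_def J'_def using has_vector_derivative_scaleR[OF DERIV_ident x2[OF w that]]
    by (simp add: add.commute)
  \<comment> \<open>Half of the derivative at s = 0 of \<open>energy\<close> for w + s u in place of
    w. Symmetry of second derivatives identifies the s-derivative of the velocity with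
    \<open>J' t\<close>.\<close>
  have variation: "DG (\<Phi> (t *\<^sub>R w)) (J t) (D (t *\<^sub>R w) w) (D (t *\<^sub>R w) w) / 2 + G (\<Phi> (t *\<^sub>R w)) (D (t *\<^sub>R w) w) (J' t)
      = G (\<Phi> 0) w u" if t: "t \<in> {0..1}" for t
  proof -
    \<comment> \<open>\<open>energy\<close> is available only for vectors in \<open>U\<close>; as
      \<open>S\<close> is open, derivatives at 0 within it are full derivatives and can be
      compared.\<close>
    define S where "S = {s. w + s *\<^sub>R u \<in> U}"
    have oS: "open S"
    proof -
      have "open ((\<lambda>s. w + s *\<^sub>R u) -` U)"
        by (rule open_vimage[OF U]) (intro continuous_intros)
      then show ?thesis by (simp add: S_def vimage_def)
    qed
    have S0: "0 \<in> S" using w by (simp add: S_def)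
    define p where "p = (\<lambda>s. t *\<^sub>R (w + s *\<^sub>R u))"
    have pU: "p s \<in> U" if "s \<in> S" for s using star[OF _ t] that by (simp add: S_def p_def)
    have p0: "p 0 = t *\<^sub>R w" by (simp add: p_def)
    have twU: "t *\<^sub>R w \<in> U" using star[OF w t] .
    have pd: "(p has_vector_derivative t *\<^sub>R u) (at 0 within S)"
      unfolding p_def by (auto intro!: derivative_eq_intros)
    have linD: "linear (D (t *\<^sub>R w))"
      using d1[OF twU] has_derivative_linear by blast
    have linDx: "linear (D x)" if "x \<in> U" for x
      using d1[OF that] has_derivative_linear by blast
    have a: "((\<lambda>s. \<Phi> (p s)) has_vector_derivative J t) (at 0 within S)"
      using has_vector_derivative_chain[OF d1 pd] twU by (simp add: p0 J_def linear_scale[OF linD])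
    have b1: "((\<lambda>s. D (p s) v) has_vector_derivative t *\<^sub>R DD v (t *\<^sub>R w) u) (at 0 within S)" for v
      using has_vector_derivative_chain[OF d2 pd] twU has_derivative_linear[OF d2[OF twU]] by (simp add: p0 linear_scale)
    have sum: "((\<lambda>s. D (p s) w + s *\<^sub>R D (p s) u) has_vector_derivative
        t *\<^sub>R DD w (t *\<^sub>R w) u + D (t *\<^sub>R w) u) (at 0 within S)"
      using has_vector_derivative_add[OF b1 has_vector_derivative_scaleR[OF DERIV_ident b1]]
      by (simp add: p0)
    have split: "D (p s) (w + s *\<^sub>R u) = D (p s) w + s *\<^sub>R D (p s) u" if "s \<in> S" for s
      using linDx[OF pU[OF that]] by (simp only: linear_add linear_scale)
    have "t *\<^sub>R DD w (t *\<^sub>R w) u + D (t *\<^sub>R w) u = J' t"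
      by (simp add: J'_def DD_sym[OF twU, of w u])
    with has_vector_derivative_transform[OF S0 split sum]
    have b: "((\<lambda>s. D (p s) (w + s *\<^sub>R u)) has_vector_derivative J' t) (at 0 within S)"
      by (simp only:)
    have c: "((\<lambda>s. w + s *\<^sub>R u) has_vector_derivative u) (at 0 within S)"
      by (auto intro!: derivative_eq_intros)
    have xV: "\<Phi> (t *\<^sub>R w) \<in> V" and zV: "\<Phi> 0 \<in> V" using \<Phi>V twU zU by blast+
    have "((\<lambda>s. G (\<Phi> (p s)) (D (p s) (w + s *\<^sub>R u)) (D (p s) (w + s *\<^sub>R u))) has_real_derivative
        DG (\<Phi> (t *\<^sub>R w)) (J t) (D (t *\<^sub>R w) w) (D (t *\<^sub>R w) w) + 2 * G (\<Phi> (t *\<^sub>R w)) (D (t *\<^sub>R w) w) (J' t)) (at 0 within S)"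
      by (rule DERIV_cong[OF has_vector_derivative_G[OF a b b S0]])
        (use \<Phi>V pU in \<open>auto simp: p0 sym[OF xV, of "J' t"]\<close>)
    moreover have "G (\<Phi> (p s)) (D (p s) (w + s *\<^sub>R u)) (D (p s) (w + s *\<^sub>R u)) = G (\<Phi> 0) (w + s *\<^sub>R u) (w + s *\<^sub>R u)"
      if "s \<in> S" for s
      unfolding p_def using that by (intro energy t) (simp add: S_def)
    moreover have "((\<lambda>s. G (\<Phi> 0) (w + s *\<^sub>R u) (w + s *\<^sub>R u)) has_real_derivative 2 * G (\<Phi> 0) w u) (at 0 within S)"
      by (rule DERIV_cong[OF has_vector_derivative_G[OF has_vector_derivative_const c c S0]])
        (use zV in \<open>auto simp: linear_0[OF lin_DG1[OF zV]] sym[OF zV, of u]\<close>)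
    ultimately have "((\<lambda>s. G (\<Phi> 0) (w + s *\<^sub>R u) (w + s *\<^sub>R u)) has_real_derivative
        DG (\<Phi> (t *\<^sub>R w)) (J t) (D (t *\<^sub>R w) w) (D (t *\<^sub>R w) w) + 2 * G (\<Phi> (t *\<^sub>R w)) (D (t *\<^sub>R w) w) (J' t)) (at 0)"
      "((\<lambda>s. G (\<Phi> 0) (w + s *\<^sub>R u) (w + s *\<^sub>R u)) has_real_derivative 2 * G (\<Phi> 0) w u) (at 0)"
      unfolding at_within_open[OF S0 oS, symmetric] has_field_derivative_def
      using S0 by (auto elim!: has_derivative_transform[rotated 2])
    from DERIV_unique[OF this] show ?thesis by simp
  qed
  \<comment> \<open>\<open>geo'\<close> tested with \<open>J\<close> turns the derivative of the
    product of velocity and \<open>J\<close> into the left side of \<open>variation\<close>, a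
    constant. So the product grows linearly from 0, and \<open>J 1\<close> is
    \<open>D w u\<close>.\<close>
  define h where "h = (\<lambda>t. G (\<Phi> (t *\<^sub>R w)) (D (t *\<^sub>R w) w) (J t) - t * G (\<Phi> 0) w u)"
  have "(h has_real_derivative 0) (at t within {0..1})" if t: "t \<in> {0..1}" for t
  proof -
    have "((\<lambda>t. G (\<Phi> (t *\<^sub>R w)) (D (t *\<^sub>R w) w) (J t)) has_real_derivative G (\<Phi> 0) w u) (at t within {0..1})"
      by (rule DERIV_cong[OF has_vector_derivative_G[OF x1[OF w t] x2[OF w t] Jd[OF t] t]])
        (use \<Phi>V star w geo'[OF w t, of "J t"] variation[OF t] in \<open>auto simp: \<Gamma>1_def algebra_simps\<close>)
    then show ?thesis unfolding h_def by (auto intro!: derivative_eq_intros)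
  qed
  from has_field_derivative_zero_constant[OF _ this] obtain c
    where "\<And>t. t \<in> {0..1} \<Longrightarrow> h t = c" by auto
  then have "h 1 = h 0" by simp
  moreover have "h 0 = 0"
    using linear_0[OF lin2] \<Phi>V zU by (simp add: h_def J_def)
  ultimately show ?thesis
    using \<Phi>V w zU by (simp add: h_def J_def sym[of "\<Phi> w" "D w u"] sym[of "\<Phi> 0" u])
qed

end

section \<open>Riemannian manifolds\<close>

locale riemannian =
  fixes A :: "('a::{second_countable_topology, t2_space}, 'e::euclidean_space) chart set"
    and g :: "('a, 'e) metric_tensor"
  assumes riem: "riemannian_manifold A g"
begin

lemma charts_atD: "c \<in> charts_at A q \<Longrightarrow> c \<in> A" "c \<in> charts_at A q \<Longrightarrow> q \<in> fst c"
  by (auto simp: charts_at_def)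

lemma is_smooth_manifold: "smooth_manifold A"
  using riem by (simp add: riemannian_manifold_def)

lemma chart:
  assumes "c \<in> A"
  shows "open (fst c)" "open (snd c ` fst c)"
    "homeomorphism (fst c) (snd c ` fst c) (snd c) (chart_inv c)"
    "continuous_on (fst c) (snd c)" "continuous_on (snd c ` fst c) (chart_inv c)"
    "q \<in> fst c \<Longrightarrow> chart_inv c (snd c q) = q"
    "x \<in> snd c ` fst c \<Longrightarrow> snd c (chart_inv c x) = x"
    "x \<in> snd c ` fst c \<Longrightarrow> chart_inv c x \<in> fst c"
  using is_smooth_manifold assms unfolding smooth_manifold_def by (auto simp: homeomorphism_def)

lemma open_chart_image:
  assumes "c \<in> A" "open N"
  shows "open (snd c ` (fst c \<inter> N))"
proof -
  have "openin (top_of_set (fst c)) (fst c \<inter> N)"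
    using assms(2) by (simp add: openin_open_Int)
  then have "openin (top_of_set (snd c ` fst c)) (snd c ` (fst c \<inter> N))"
    by (rule homeomorphism_imp_open_map[OF chart(3)[OF assms(1)]])
  then show ?thesis
    using chart(2)[OF assms(1)] openin_open_trans by blast
qed

lemma transition_derivative:
  assumes "c \<in> charts_at A q" "d \<in> charts_at A q"
  shows "((snd d \<circ> chart_inv c) has_derivative frechet_derivative (snd d \<circ> chart_inv c) (at (snd c q)))
    (at (snd c q))"
proof (rule smooth_on_open(1))
  show "open (snd c ` (fst c \<inter> fst d))"
    by (intro open_chart_image chart charts_atD[OF assms(1)] charts_atD[OF assms(2)])
  show "smooth_on (snd c ` (fst c \<inter> fst d)) (snd d \<circ> chart_inv c)"
    using is_smooth_manifold assms by (simp add: smooth_manifold_def charts_at_def)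
  show "snd c q \<in> snd c ` (fst c \<inter> fst d)"
    using assms by (simp add: charts_at_def)
qed

lemma of_coord_self:
  assumes c: "c \<in> charts_at A q"
  shows "of_coord A q c u c = u"
proof -
  have "((snd c \<circ> chart_inv c) has_derivative (\<lambda>x. x)) (at (snd c q))"
    by (rule has_derivative_transform_within_open[OF has_derivative_ident chart(2)[OF charts_atD(1)[OF c]]])
      (auto simp: chart(6)[OF charts_atD(1)[OF c]] charts_atD(2)[OF c])
  then have "frechet_derivative (snd c \<circ> chart_inv c) (at (snd c q)) = (\<lambda>x. x)"
    using frechet_derivative_at by metis
  then show ?thesis using c by (simp add: of_coord_def)
qed

text \<open>The Jacobians of coordinate changes satisfy the cocycle rule, by the chain rule on the
  overlap of \<open>c\<close> and \<open>d\<close>.\<close>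

lemma of_coord_in_tangent_space:
  assumes c: "c \<in> charts_at A q"
  shows "of_coord A q c u \<in> tangent_space A q"
proof -
  have "of_coord A q c u d' = frechet_derivative (snd d' \<circ> chart_inv d) (at (snd d q)) (of_coord A q c u d)"
    if d: "d \<in> charts_at A q" and d': "d' \<in> charts_at A q" for d d'
  proof -
    have qq: "(snd d \<circ> chart_inv c) (snd c q) = snd d q"
      using chart(6)[OF charts_atD[OF c]] by simp
    have "((snd d' \<circ> chart_inv d) \<circ> (snd d \<circ> chart_inv c) has_derivative
        frechet_derivative (snd d' \<circ> chart_inv d) (at (snd d q)) \<circ>
        frechet_derivative (snd d \<circ> chart_inv c) (at (snd c q))) (at (snd c q))"
      using diff_chain_at[OF transition_derivative[OF c d]] transition_derivative[OF d d'] qq by simp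
    then have "((snd d' \<circ> chart_inv c) has_derivative
        frechet_derivative (snd d' \<circ> chart_inv d) (at (snd d q)) \<circ>
        frechet_derivative (snd d \<circ> chart_inv c) (at (snd c q))) (at (snd c q))"
    proof (rule has_derivative_transform_within_open)
      show "open (snd c ` (fst c \<inter> fst d))"
        by (intro open_chart_image chart charts_atD[OF c] charts_atD[OF d])
      show "snd c q \<in> snd c ` (fst c \<inter> fst d)"
        using charts_atD[OF c] charts_atD[OF d] by simp
      show "((snd d' \<circ> chart_inv d) \<circ> (snd d \<circ> chart_inv c)) x = (snd d' \<circ> chart_inv c) x"
        if "x \<in> snd c ` (fst c \<inter> fst d)" for x
        using that by (auto simp: chart(6)[OF charts_atD(1)[OF c]] chart(6)[OF charts_atD(1)[OF d]])
    qed
    from fun_cong[OF frechet_derivative_at[OF this], of u] show ?thesis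
      using d d' by (simp add: of_coord_def)
  qed
  moreover have "of_coord A q c u d = 0" if "d \<notin> charts_at A q" for d
    using that by (simp add: of_coord_def)
  ultimately show ?thesis unfolding tangent_space_def by blast
qed

lemma tangent_eq_of_coord:
  assumes "X \<in> tangent_space A q" "c \<in> charts_at A q"
  shows "X = of_coord A q c (X c)"
proof
  fix d
  show "X d = of_coord A q c (X c) d"
  proof (cases "d \<in> charts_at A q")
    case True
    then have "X d = frechet_derivative (snd d \<circ> chart_inv c) (at (snd c q)) (X c)"
      using assms unfolding tangent_space_def by blast
    with True show ?thesis unfolding of_coord_def by presburger
  next
    case False
    moreover from this have "X d = 0" using assms(1) unfolding tangent_space_def by blast
    ultimately show ?thesis unfolding of_coord_def by presburger
  qed
qed

lemma of_coord_add_scale: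
  assumes c: "c \<in> charts_at A q"
  shows "of_coord A q c (r *\<^sub>R u + v) = tadd (tscale r (of_coord A q c u)) (of_coord A q c v)"
proof
  fix d
  show "of_coord A q c (r *\<^sub>R u + v) d = tadd (tscale r (of_coord A q c u)) (of_coord A q c v) d"
    using has_derivative_linear[OF transition_derivative[OF c, of d]]
    by (cases "d \<in> charts_at A q") (auto simp: of_coord_def tadd_def tscale_def linear_add linear_scale)
qed

lemma of_coord_scale:
  assumes c: "c \<in> charts_at A q"
  shows "of_coord A q c (r *\<^sub>R u) = tscale r (of_coord A q c u)"
proof
  fix d
  show "of_coord A q c (r *\<^sub>R u) d = tscale r (of_coord A q c u) d"
    using has_derivative_linear[OF transition_derivative[OF c, of d]]
    by (cases "d \<in> charts_at A q") (auto simp: of_coord_def tscale_def linear_scale)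
qed

lemma carrier_charts_at: "q \<in> carrier A \<longleftrightarrow> (\<exists>c. c \<in> charts_at A q)"
  unfolding carrier_def charts_at_def by blast

lemma metric_of_coord:
  assumes c: "c \<in> charts_at A q"
  shows "g q (of_coord A q c u) (of_coord A q c v) = metric_coord A g c (snd c q) u v"
  using chart(6)[OF charts_atD[OF c]] by (simp add: metric_coord_def)

lemma metric_tensor:
  assumes "c \<in> charts_at A q"
  shows "X \<in> tangent_space A q \<Longrightarrow> Y \<in> tangent_space A q \<Longrightarrow> g q X Y = g q Y X"
    "X \<in> tangent_space A q \<Longrightarrow> Y \<in> tangent_space A q \<Longrightarrow> Z \<in> tangent_space A q \<Longrightarrow>
       g q (tadd (tscale r X) Y) Z = r * g q X Z + g q Y Z"
    "X \<in> tangent_space A q \<Longrightarrow> X \<noteq> (\<lambda>c. 0) \<Longrightarrow> 0 < g q X X"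
  using riem assms carrier_charts_at unfolding riemannian_manifold_def by blast+

lemma coordinate_metric:
  assumes cA: "c \<in> A"
  shows "coordinate_metric (snd c ` fst c) (metric_coord A g c)"
proof -
  have c: "c \<in> charts_at A (chart_inv c x)" if "x \<in> snd c ` fst c" for x
    using chart(8)[OF cA that] cA by (simp add: charts_at_def)
  note T = of_coord_in_tangent_space[OF c]
  have sym: "metric_coord A g c x u v = metric_coord A g c x v u" if "x \<in> snd c ` fst c" for x u v
    unfolding metric_coord_def by (rule metric_tensor(1)[OF c T T]) (rule that)+
  have *: "metric_coord A g c x (r *\<^sub>R u + v) w = r * metric_coord A g c x u w + metric_coord A g c x v w"
    if "x \<in> snd c ` fst c" for x r u v w
    unfolding metric_coord_def of_coord_add_scale[OF c[OF that]]
    by (rule metric_tensor(2)[OF c T T T]) (rule that)+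
  have lin: "linear (metric_coord A g c x u)" if x: "x \<in> snd c ` fst c" for x u
  proof (rule linearI)
    fix v w and r :: real
    have 0: "metric_coord A g c x 0 w = 0" for w
      using *[OF x, of 1 0 0 w] by simp
    show "metric_coord A g c x u (v + w) = metric_coord A g c x u v + metric_coord A g c x u w"
      using *[OF x, of 1 v w u] by (simp add: sym[OF x, of u])
    show "metric_coord A g c x u (r *\<^sub>R v) = r *\<^sub>R metric_coord A g c x u v"
      using *[OF x, of r v 0 u] by (simp add: sym[OF x, of u] 0)
  qed
  have pos: "0 < metric_coord A g c x u u" if x: "x \<in> snd c ` fst c" and "u \<noteq> 0" for x u
  proof -
    have "of_coord A (chart_inv c x) c u \<noteq> (\<lambda>c. 0)"
      using of_coord_self[OF c[OF x], of u] that by auto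
    then show ?thesis
      unfolding metric_coord_def by (rule metric_tensor(3)[OF c[OF x] T[OF x]])
  qed
  have C2: "Ck_on (Suc (Suc 0)) (\<lambda>x. metric_coord A g c x u v) (snd c ` fst c)" for u v
    using riem cA unfolding riemannian_manifold_def smooth_on_def by blast
  show ?thesis
    by (intro coordinate_metric.intro) (fact chart(2)[OF cA] lin sym pos C2)+
qed

section \<open>Curves and geodesics in a chart\<close>

text \<open>A name for \<Gamma>1 in statements where no chart is fixed by an interpretation.\<close>

definition chart_\<Gamma>1 :: "('a, 'e) chart \<Rightarrow> 'e \<Rightarrow> 'e \<Rightarrow> 'e \<Rightarrow> real" where
  "chart_\<Gamma>1 c = coordinate_metric.\<Gamma>1 (metric_coord A g c)"

text \<open>The description in \<open>christoffel\<close> is proper: a positive definite form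
  represents the right-hand side by a vector, and by only one. For equal lower arguments the first
  two terms coincide, which gives \<Gamma>1.\<close>

lemma metric_christoffel:
  assumes cA: "c \<in> A" and x: "x \<in> snd c ` fst c"
  shows "metric_coord A g c x (christoffel A g c x v v) w = chart_\<Gamma>1 c x v w"
proof -
  interpret coordinate_metric "snd c ` fst c" "metric_coord A g c"
    by (rule coordinate_metric[OF cA])
  let ?P = "\<lambda>z. \<forall>w. metric_coord A g c x z w = (DG x v v w + DG x v v w - DG x w v v) / 2"
  have lin: "linear (\<lambda>w. (DG x v v w + DG x v v w - DG x w v v) / 2)"
    by (intro linearI) (simp_all add: DG_add1[OF x] DG_add3[OF x] DG_scale1[OF x] DG_scale3[OF x] field_simps)
  have ex: "\<exists>z. ?P z"
    by (rule linear_functional_representation[OF lin1[OF x] lin2[OF x] pos[OF x] lin])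
  have "z = z'" if "?P z" "?P z'" for z z'
  proof (rule ccontr)
    assume "z \<noteq> z'"
    then have "0 < metric_coord A g c x (z - z') (z - z')" by (intro pos[OF x]) simp
    then show False using that by (simp add: G_diff1[OF x])
  qed
  with ex have "\<exists>!z. ?P z" by blast
  from theI'[OF this] have "metric_coord A g c x (christoffel A g c x v v) w = (DG x v v w + DG x v v w - DG x w v v) / 2"
    unfolding christoffel_def DG_def by blast
  then show ?thesis by (simp add: chart_\<Gamma>1_def \<Gamma>1_def field_simps)
qed

abbreviation (input) chart_velocity ::
  "('a, 'e) chart \<Rightarrow> real set \<Rightarrow> (real \<Rightarrow> 'a) \<Rightarrow> real \<Rightarrow> 'e" where
  "chart_velocity c J \<gamma> t \<equiv> vector_derivative (snd c \<circ> \<gamma>) (at t within J)"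

abbreviation (input) chart_acceleration ::
  "('a, 'e) chart \<Rightarrow> real set \<Rightarrow> (real \<Rightarrow> 'a) \<Rightarrow> real \<Rightarrow> 'e" where
  "chart_acceleration c J \<gamma> t \<equiv> vector_derivative (\<lambda>\<tau>. chart_velocity c J \<gamma> \<tau>) (at t within J)"

text \<open>A derivative in chart \<open>c\<close> makes sense only where the curve lies in
  \<open>fst c\<close>. The set \<open>S\<close> of these times is a neighborhood of
  \<open>t\<close> in \<open>J\<close>, so the second derivative sees nothing else.\<close>

lemma smooth_curve:
  assumes \<gamma>: "smooth_into A J \<gamma>" and J: "\<And>t. t \<in> J \<Longrightarrow> at t within J \<noteq> bot"
    and t: "t \<in> J" and c: "c \<in> charts_at A (\<gamma> t)"
  shows "((snd c \<circ> \<gamma>) has_vector_derivative chart_velocity c J \<gamma> t) (at t within J)"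
    and "((\<lambda>\<tau>. chart_velocity c J \<gamma> \<tau>) has_vector_derivative chart_acceleration c J \<gamma> t) (at t within J)"
proof -
  note cA = charts_atD[OF c]
  define S where "S = J \<inter> \<gamma> -` fst c"
  define f where "f = snd c \<circ> \<gamma>"
  define F where "F = (\<lambda>\<tau>. frechet_derivative f (at \<tau> within S) 1)"
  have cont: "continuous_on J \<gamma>" using \<gamma> by (simp add: smooth_into_def)
  have atS: "at \<tau> within S = at \<tau> within J" if "\<tau> \<in> S" for \<tau>
    unfolding S_def using that by (intro at_within_vimage[OF cont chart(1)[OF cA(1)]]) (auto simp: S_def)
  have tS: "t \<in> S" using t cA by (simp add: S_def)
  have "smooth_on S f"
    using \<gamma> cA by (auto simp: smooth_into_def S_def f_def)
  then have "Ck_on (Suc (Suc 0)) f S" unfolding smooth_on_def by blast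
  then have d1: "f differentiable (at \<tau> within S)" and d2: "F differentiable (at \<tau> within S)" if "\<tau> \<in> S" for \<tau>
    using that by (auto simp: F_def)
  have v1: "(f has_vector_derivative F \<tau>) (at \<tau> within J)" if "\<tau> \<in> S" for \<tau>
    using has_vector_derivative_frechet[OF d1[OF that]] unfolding F_def atS[OF that] .
  have F: "vector_derivative f (at \<tau> within J) = F \<tau>" if "\<tau> \<in> S" for \<tau>
    using that by (intro vector_derivative_within J v1) (simp add: S_def)
  show "((snd c \<circ> \<gamma>) has_vector_derivative chart_velocity c J \<gamma> t) (at t within J)"
    using v1[OF tS] F[OF tS] by (simp add: f_def)
  have "(F has_vector_derivative frechet_derivative F (at t within S) 1) (at t within S)"
    by (rule has_vector_derivative_frechet[OF d2[OF tS]])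
  then have "((\<lambda>\<tau>. vector_derivative f (at \<tau> within J)) has_vector_derivative
      frechet_derivative F (at t within S) 1) (at t within S)"
    by (rule has_vector_derivative_transform[rotated 2]) (rule tS, rule F)
  then have *: "((\<lambda>\<tau>. vector_derivative f (at \<tau> within J)) has_vector_derivative
      frechet_derivative F (at t within S) 1) (at t within J)"
    unfolding atS[OF tS] .
  show "((\<lambda>\<tau>. chart_velocity c J \<gamma> \<tau>) has_vector_derivative chart_acceleration c J \<gamma> t) (at t within J)"
    using * vector_derivative_within[OF J[OF t] *] by (simp add: f_def)
qed

text \<open>By the chain rule through the coordinate changes, the family \<open>velocity\<close> is
  one tangent vector; its products can be computed in any single chart.\<close>

lemma velocity_eq_of_coord:
  assumes \<gamma>: "smooth_into A J \<gamma>" and J: "\<And>t. t \<in> J \<Longrightarrow> at t within J \<noteq> bot"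
    and t: "t \<in> J" and c: "c \<in> charts_at A (\<gamma> t)"
  shows "velocity A J \<gamma> t = of_coord A (\<gamma> t) c (chart_velocity c J \<gamma> t)"
proof
  fix d
  show "velocity A J \<gamma> t d = of_coord A (\<gamma> t) c (chart_velocity c J \<gamma> t) d"
  proof (cases "d \<in> charts_at A (\<gamma> t)")
    case d: True
    note cA = charts_atD[OF c]
    let ?T = "frechet_derivative (snd d \<circ> chart_inv c) (at (snd c (\<gamma> t)))"
    have cont: "continuous_on J \<gamma>" using \<gamma> by (simp add: smooth_into_def)
    define S where "S = J \<inter> \<gamma> -` fst c"
    have atS: "at t within S = at t within J"
      unfolding S_def by (rule at_within_vimage[OF cont chart(1)[OF cA(1)] t cA(2)])
    have T: "((snd d \<circ> chart_inv c) has_derivative ?T) (at ((snd c \<circ> \<gamma>) t))"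
      using transition_derivative[OF c d] by simp
    have v: "((snd c \<circ> \<gamma>) has_derivative (\<lambda>h. h *\<^sub>R chart_velocity c J \<gamma> t)) (at t within S)"
      using smooth_curve(1)[OF \<gamma> J t c] unfolding atS has_vector_derivative_def .
    have "(((snd d \<circ> chart_inv c) \<circ> (snd c \<circ> \<gamma>)) has_vector_derivative ?T (chart_velocity c J \<gamma> t)) (at t within S)"
      using diff_chain_within[OF v has_derivative_at_withinI[OF T]] linear_scale[OF has_derivative_linear[OF T]]
      by (simp add: has_vector_derivative_def o_def)
    then have "((snd d \<circ> \<gamma>) has_vector_derivative ?T (chart_velocity c J \<gamma> t)) (at t within S)"
      by (rule has_vector_derivative_transform[rotated 2])
        (use t cA in \<open>simp_all add: S_def chart(6)[OF cA(1)]\<close>)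
    then have "chart_velocity d J \<gamma> t = ?T (chart_velocity c J \<gamma> t)"
      unfolding atS by (rule vector_derivative_within[OF J[OF t]])
    then show ?thesis using d by (simp add: velocity_def of_coord_def)
  qed (simp add: velocity_def of_coord_def)
qed

lemma geodesic_in_chart:
  assumes geo: "geodesic A g J \<gamma>" and t: "t \<in> J" and c: "c \<in> charts_at A (\<gamma> t)"
  shows "metric_coord A g c (snd c (\<gamma> t)) (chart_acceleration c J \<gamma> t) w =
    - chart_\<Gamma>1 c (snd c (\<gamma> t)) (chart_velocity c J \<gamma> t) w"
proof -
  note cA = charts_atD[OF c]
  interpret coordinate_metric "snd c ` fst c" "metric_coord A g c"
    by (rule coordinate_metric[OF cA(1)])
  have x: "snd c (\<gamma> t) \<in> snd c ` fst c" using cA by blast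
  have "chart_acceleration c J \<gamma> t =
      - christoffel A g c (snd c (\<gamma> t)) (chart_velocity c J \<gamma> t) (chart_velocity c J \<gamma> t)"
    using geo t c unfolding geodesic_def by (metis add_eq_0_iff2)
  then show ?thesis
    using metric_christoffel[OF cA(1) x, of "chart_velocity c J \<gamma> t" w] linear_neg[OF lin1[OF x]] by simp
qed

lemma unit_interval_ne_bot: "t \<in> {0..1::real} \<Longrightarrow> at t within {0..1} \<noteq> bot"
  by (rule at_within_interval_ne_bot) auto

section \<open>Global uniqueness of geodesics\<close>

text \<open>Local uniqueness is continued along [0, 1]: at the infimum \<sigma> of the times of
  disagreement, position and velocity still agree, so the curves agree a little longer.\<close>

lemma geodesic_from_unique:
  assumes \<gamma>: "geodesic_from A g p v \<gamma>" and \<eta>: "geodesic_from A g p v \<eta>" and t: "t \<in> {0..1}"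
  shows "\<gamma> t = \<eta> t"
proof (rule ccontr)
  assume ne: "\<gamma> t \<noteq> \<eta> t"
  have geo: "geodesic A g {0..1} \<gamma>" "geodesic A g {0..1} \<eta>"
    and init: "\<gamma> 0 = p" "\<eta> 0 = p" "velocity A {0..1} \<gamma> 0 = v" "velocity A {0..1} \<eta> 0 = v"
    using \<gamma> \<eta> by (auto simp: geodesic_from_def)
  have sm: "smooth_into A {0..1} \<gamma>" "smooth_into A {0..1} \<eta>"
    using geo by (auto simp: geodesic_def)
  then have cont: "continuous_on {0..1} \<gamma>" "continuous_on {0..1} \<eta>"
    and car: "\<And>s. s \<in> {0..1} \<Longrightarrow> \<gamma> s \<in> carrier A" "\<And>s. s \<in> {0..1} \<Longrightarrow> \<eta> s \<in> carrier A"
    by (auto simp: smooth_into_def)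
  define B where "B = {s \<in> {0..1}. \<gamma> s \<noteq> \<eta> s}"
  define \<sigma> where "\<sigma> = Inf B"
  have tB: "t \<in> B" using t ne by (simp add: B_def)
  have bdd: "bdd_below B" by (auto simp: B_def intro!: bdd_belowI[of _ 0])
  have \<sigma>: "\<sigma> \<in> {0..1}"
    using tB t cInf_lower[OF tB bdd] cInf_greatest[of B 0] by (fastforce simp: \<sigma>_def B_def)
  have below: "\<gamma> s = \<eta> s" if "0 \<le> s" "s < \<sigma>" for s
  proof (rule ccontr)
    assume "\<gamma> s \<noteq> \<eta> s"
    then have "s \<in> B" using that \<sigma> by (simp add: B_def)
    from cInf_lower[OF this bdd] show False using that by (simp add: \<sigma>_def)
  qed
  have at\<sigma>: "\<gamma> \<sigma> = \<eta> \<sigma>"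
  proof (cases "\<sigma> = 0")
    case True
    then show ?thesis using init by simp
  next
    case False
    then have pos: "0 < \<sigma>" using \<sigma> by simp
    \<comment> \<open>The curves have equal left limits at \<sigma>; the Hausdorff property makes
      these limits unique.\<close>
    have nb: "at \<sigma> within {0..<\<sigma>} \<noteq> bot"
      using pos by (simp add: trivial_limit_within islimpt_Ico)
    have 1: "(\<gamma> \<longlongrightarrow> \<gamma> \<sigma>) (at \<sigma> within {0..<\<sigma>})" "(\<eta> \<longlongrightarrow> \<eta> \<sigma>) (at \<sigma> within {0..<\<sigma>})"
      by (rule tendsto_within_subset[OF continuous_on_def[THEN iffD1, rule_format, OF cont(1) \<sigma>]]
          tendsto_within_subset[OF continuous_on_def[THEN iffD1, rule_format, OF cont(2) \<sigma>]],
          use \<sigma> in auto)+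
    have "\<forall>\<^sub>F s in at \<sigma> within {0..<\<sigma>}. \<gamma> s = \<eta> s"
      using below by (auto simp: eventually_at_filter)
    from tendsto_cong[OF this] 1 have "(\<eta> \<longlongrightarrow> \<gamma> \<sigma>) (at \<sigma> within {0..<\<sigma>})" by blast
    then show ?thesis using tendsto_unique[OF nb] 1(2) by blast
  qed
  obtain c where c: "c \<in> charts_at A (\<gamma> \<sigma>)"
    using car(1)[OF \<sigma>] carrier_charts_at by blast
  note cA = charts_atD[OF c]
  have c': "c \<in> charts_at A (\<eta> \<sigma>)" using c at\<sigma> by simp
  define x where "x = snd c \<circ> \<gamma>"
  define y where "y = snd c \<circ> \<eta>"
  let ?V = "snd c ` fst c"
  interpret coordinate_metric ?V "metric_coord A g c"
    by (rule coordinate_metric[OF cA(1)])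
  have x\<sigma>: "x \<sigma> = y \<sigma>" using at\<sigma> by (simp add: x_def y_def)
  \<comment> \<open>If \<sigma> = 0, the common initial velocity is given. Otherwise the derivatives
    from the left determine the velocities, and the curves agree there.\<close>
  have v\<sigma>: "chart_velocity c {0..1} \<gamma> \<sigma> = chart_velocity c {0..1} \<eta> \<sigma>"
  proof (cases "\<sigma> = 0")
    case True
    then show ?thesis
      using fun_cong[OF trans[OF init(3) init(4)[symmetric]], of c] c c' by (simp add: velocity_def)
  next
    case False
    then have pos: "0 < \<sigma>" using \<sigma> by simp
    have sub: "{0..\<sigma>} \<subseteq> {0..1}" using \<sigma> by auto
    have "(x has_vector_derivative chart_velocity c {0..1} \<gamma> \<sigma>) (at \<sigma> within {0..\<sigma>})"
      using has_vector_derivative_within_subset[OF smooth_curve(1)[OF sm(1) unit_interval_ne_bot \<sigma> c] sub]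
      by (simp add: x_def)
    moreover have "(y has_vector_derivative chart_velocity c {0..1} \<eta> \<sigma>) (at \<sigma> within {0..\<sigma>})"
      using has_vector_derivative_within_subset[OF smooth_curve(1)[OF sm(2) unit_interval_ne_bot \<sigma> c'] sub]
      by (simp add: y_def)
    then have "(x has_vector_derivative chart_velocity c {0..1} \<eta> \<sigma>) (at \<sigma> within {0..\<sigma>})"
    proof (rule has_vector_derivative_transform[rotated 2])
      show "x s = y s" if "s \<in> {0..\<sigma>}" for s
        using that below[of s] at\<sigma> by (cases "s = \<sigma>") (auto simp: x_def y_def)
    qed (use pos in simp)
    ultimately show ?thesis
      using vector_derivative_unique_within_closed_interval[of 0 \<sigma> \<sigma>] pos by auto
  qed
  \<comment> \<open>A closed coordinate ball is the compact convex set that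
    \<open>geodesic_equation_unique\<close> asks for.\<close>
  obtain r where r: "0 < r" "cball (x \<sigma>) r \<subseteq> ?V"
    using chart(2)[OF cA(1)] cA(2) open_contains_cball by (metis comp_apply image_eqI x_def)
  define N where "N = fst c \<inter> snd c -` ball (x \<sigma>) r"
  have oN: "open N"
    unfolding N_def using continuous_open_preimage[OF chart(4)[OF cA(1)] chart(1)[OF cA(1)] open_ball] .
  have N\<gamma>: "\<gamma> \<sigma> \<in> N" "\<eta> \<sigma> \<in> N" using cA r at\<sigma> by (auto simp: N_def x_def)
  obtain e1 where e1: "0 < e1" "\<And>s. s \<in> {0..1} \<Longrightarrow> dist s \<sigma> < e1 \<Longrightarrow> \<gamma> s \<in> N"
    using continuous_on_open_nbhd[OF cont(1) oN \<sigma> N\<gamma>(1)] by metis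
  obtain e2 where e2: "0 < e2" "\<And>s. s \<in> {0..1} \<Longrightarrow> dist s \<sigma> < e2 \<Longrightarrow> \<eta> s \<in> N"
    using continuous_on_open_nbhd[OF cont(2) oN \<sigma> N\<gamma>(2)] by metis
  define e where "e = min e1 e2 / 2"
  have e: "0 < e" "e < e1" "e < e2" using e1 e2 by (auto simp: e_def)
  define b where "b = min 1 (\<sigma> + e)"
  have sub: "{\<sigma>..b} \<subseteq> {0..1}" using \<sigma> by (auto simp: b_def)
  have inN: "\<gamma> s \<in> N" "\<eta> s \<in> N" if "s \<in> {\<sigma>..b}" for s
    using that sub e e1(2)[of s] e2(2)[of s] by (auto simp: b_def dist_real_def)
  have cs: "c \<in> charts_at A (\<gamma> s)" "c \<in> charts_at A (\<eta> s)" if "s \<in> {\<sigma>..b}" for s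
    using inN[OF that] cA by (auto simp: N_def charts_at_def)
  have eq: "x s = y s" if s: "s \<in> {\<sigma>..b}" for s
  proof (rule geodesic_equation_unique[where x=x and y=y and a=\<sigma> and b=b and K="cball (x \<sigma>) r"
        and ?x1.0="\<lambda>s. chart_velocity c {0..1} \<gamma> s" and ?x2.0="\<lambda>s. chart_acceleration c {0..1} \<gamma> s"
        and ?y1.0="\<lambda>s. chart_velocity c {0..1} \<eta> s" and ?y2.0="\<lambda>s. chart_acceleration c {0..1} \<eta> s"])
    fix s assume s: "s \<in> {\<sigma>..b}"
    then have s1: "s \<in> {0..1}" using sub by blast
    show "(x has_vector_derivative chart_velocity c {0..1} \<gamma> s) (at s within {\<sigma>..b})"
      unfolding x_def
      by (rule has_vector_derivative_within_subset[OF smooth_curve(1)[OF sm(1) unit_interval_ne_bot s1 cs(1)[OF s]] sub])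
    show "(y has_vector_derivative chart_velocity c {0..1} \<eta> s) (at s within {\<sigma>..b})"
      unfolding y_def
      by (rule has_vector_derivative_within_subset[OF smooth_curve(1)[OF sm(2) unit_interval_ne_bot s1 cs(2)[OF s]] sub])
    show "((\<lambda>s. chart_velocity c {0..1} \<gamma> s) has_vector_derivative chart_acceleration c {0..1} \<gamma> s) (at s within {\<sigma>..b})"
      by (rule has_vector_derivative_within_subset[OF smooth_curve(2)[OF sm(1) unit_interval_ne_bot s1 cs(1)[OF s]] sub])
    show "((\<lambda>s. chart_velocity c {0..1} \<eta> s) has_vector_derivative chart_acceleration c {0..1} \<eta> s) (at s within {\<sigma>..b})"
      by (rule has_vector_derivative_within_subset[OF smooth_curve(2)[OF sm(2) unit_interval_ne_bot s1 cs(2)[OF s]] sub])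
    show "metric_coord A g c (x s) (chart_acceleration c {0..1} \<gamma> s) w = - \<Gamma>1 (x s) (chart_velocity c {0..1} \<gamma> s) w" for w
      using geodesic_in_chart[OF geo(1) s1 cs(1)[OF s]] by (simp add: x_def chart_\<Gamma>1_def)
    show "metric_coord A g c (y s) (chart_acceleration c {0..1} \<eta> s) w = - \<Gamma>1 (y s) (chart_velocity c {0..1} \<eta> s) w" for w
      using geodesic_in_chart[OF geo(2) s1 cs(2)[OF s]] by (simp add: y_def chart_\<Gamma>1_def)
    show "x s \<in> cball (x \<sigma>) r" "y s \<in> cball (x \<sigma>) r"
      using inN[OF s] by (auto simp: N_def x_def y_def)
  qed (rule compact_cball convex_cball r(2) x\<sigma> v\<sigma> s)+
  have eq': "\<gamma> s = \<eta> s" if s: "s \<in> {\<sigma>..b}" for s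
    using eq[OF s] chart(6)[OF charts_atD[OF cs(1)[OF s]]] chart(6)[OF charts_atD[OF cs(2)[OF s]]]
    unfolding x_def y_def comp_apply by metis
  have lower: "b < s" if "s \<in> B" for s
  proof (rule ccontr)
    assume "\<not> b < s"
    moreover have "\<sigma> \<le> s" using cInf_lower[OF that bdd] by (simp add: \<sigma>_def)
    ultimately have "\<gamma> s = \<eta> s" by (intro eq') simp
    then show False using that by (simp add: B_def)
  qed
  \<comment> \<open>A disagreement later than \<open>b\<close> excludes b = 1, so \<open>b\<close>
    is \<sigma> + e: a lower bound of \<open>B\<close> above its infimum.\<close>
  have "b < 1" using lower[OF tB] t by simp
  then have b: "b = \<sigma> + e" unfolding b_def by linarith
  have "b \<le> Inf B"
    using tB lower by (intro cInf_greatest) (blast, meson less_imp_le)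
  then show False using e b \<sigma>_def by linarith
qed

section \<open>The exponential map along rays\<close>

lemma exp_map_eq:
  assumes "geodesic_from A g p v \<gamma>"
  shows "exp_map A g p v = \<gamma> 1"
  unfolding exp_map_def
proof (rule the_equality)
  show "\<exists>\<eta>. geodesic_from A g p v \<eta> \<and> \<gamma> 1 = \<eta> 1" using assms by blast
  show "q = \<gamma> 1" if ex: "\<exists>\<eta>. geodesic_from A g p v \<eta> \<and> q = \<eta> 1" for q
  proof -
    obtain \<eta> where "geodesic_from A g p v \<eta>" "q = \<eta> 1" using ex by blast
    then show ?thesis using geodesic_from_unique[OF _ assms, of \<eta> 1] by simp
  qed
qed

text \<open>The reparametrization multiplies the velocity by t and the acceleration by t^2, and the
  Christoffel term is quadratic in the velocity.\<close>

lemma geodesic_from_rescale: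
  assumes \<gamma>: "geodesic_from A g p v \<gamma>" and t: "0 < t" "t \<le> 1"
  shows "geodesic_from A g p (tscale t v) (\<lambda>\<tau>. \<gamma> (t * \<tau>))"
proof -
  have geo: "geodesic A g {0..1} \<gamma>" and init: "\<gamma> 0 = p" "velocity A {0..1} \<gamma> 0 = v"
    using \<gamma> by (auto simp: geodesic_from_def)
  have sm: "smooth_into A {0..1} \<gamma>" using geo by (simp add: geodesic_def)
  have cont: "continuous_on {0..1} \<gamma>" and car: "\<gamma> ` {0..1} \<subseteq> carrier A"
    using sm by (auto simp: smooth_into_def)
  define \<eta> where "\<eta> = (\<lambda>\<tau>. \<gamma> (t * \<tau>))"
  have tt: "t * \<tau> \<in> {0..1}" if "\<tau> \<in> {0..1}" for \<tau>
    using that t by (auto simp: mult_le_one)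
  have cont\<eta>: "continuous_on {0..1} \<eta>"
    unfolding \<eta>_def by (rule continuous_on_compose2[OF cont]) (use tt in \<open>auto intro!: continuous_intros\<close>)
  have sm\<eta>: "smooth_into A {0..1} \<eta>"
    unfolding smooth_into_def
  proof (intro conjI ballI)
    show "continuous_on {0..1} \<eta>" by (rule cont\<eta>)
    show "\<eta> ` {0..1} \<subseteq> carrier A" using car tt by (auto simp: \<eta>_def)
    fix d assume d: "d \<in> A"
    have "Ck_on k (snd d \<circ> \<gamma>) ({0..1} \<inter> \<gamma> -` fst d)" for k
      using sm d by (simp add: smooth_into_def smooth_on_def)
    then have "Ck_on k (\<lambda>\<tau>. (snd d \<circ> \<gamma>) (t * \<tau>)) ({0..1} \<inter> \<eta> -` fst d)" for k
    proof (rule Ck_on_rescale)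
      fix \<tau> assume \<tau>: "\<tau> \<in> {0..1} \<inter> \<eta> -` fst d"
      then show "t * \<tau> \<in> {0..1} \<inter> \<gamma> -` fst d" using tt by (auto simp: \<eta>_def)
      show "at \<tau> within {0..1} \<inter> \<eta> -` fst d \<noteq> bot"
        using at_within_vimage[OF cont\<eta> chart(1)[OF d], of \<tau>] \<tau> unit_interval_ne_bot[of \<tau>] by simp
    qed
    then show "smooth_on ({0..1} \<inter> \<eta> -` fst d) (snd d \<circ> \<eta>)"
      by (simp add: smooth_on_def \<eta>_def o_def)
  qed
  have d1: "chart_velocity c {0..1} \<eta> \<tau> = t *\<^sub>R chart_velocity c {0..1} \<gamma> (t * \<tau>)"
    if \<tau>: "\<tau> \<in> {0..1}" and c: "c \<in> charts_at A (\<eta> \<tau>)" for \<tau> c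
  proof -
    have c': "c \<in> charts_at A (\<gamma> (t * \<tau>))" using c by (simp add: \<eta>_def)
    have "((\<lambda>\<tau>. t * \<tau>) has_vector_derivative t) (at \<tau> within {0..1})"
      by (auto intro!: derivative_eq_intros)
    moreover have "((snd c \<circ> \<gamma>) has_vector_derivative chart_velocity c {0..1} \<gamma> (t * \<tau>))
        (at (t * \<tau>) within (\<lambda>\<tau>. t * \<tau>) ` {0..1})"
      using smooth_curve(1)[OF sm unit_interval_ne_bot tt[OF \<tau>] c']
      by (rule has_vector_derivative_within_subset) (use tt in auto)
    ultimately have "((snd c \<circ> \<eta>) has_vector_derivative t *\<^sub>R chart_velocity c {0..1} \<gamma> (t * \<tau>)) (at \<tau> within {0..1})"
      using vector_diff_chain_within[of "\<lambda>\<tau>. t * \<tau>"] by (simp add: \<eta>_def o_def)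
    then show ?thesis by (rule vector_derivative_within[OF unit_interval_ne_bot[OF \<tau>]])
  qed
  have d2: "chart_acceleration c {0..1} \<eta> \<tau> = t\<^sup>2 *\<^sub>R chart_acceleration c {0..1} \<gamma> (t * \<tau>)"
    if \<tau>: "\<tau> \<in> {0..1}" and c: "c \<in> charts_at A (\<eta> \<tau>)" for \<tau> c
  proof -
    note cA = charts_atD[OF c]
    have c': "c \<in> charts_at A (\<gamma> (t * \<tau>))" using c by (simp add: \<eta>_def)
    define S where "S = {0..1} \<inter> \<eta> -` fst c"
    have atS: "at \<tau> within S = at \<tau> within {0..1}"
      unfolding S_def by (rule at_within_vimage[OF cont\<eta> chart(1)[OF cA(1)] \<tau> cA(2)])
    have "((\<lambda>\<tau>. t * \<tau>) has_vector_derivative t) (at \<tau> within {0..1})"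
      by (auto intro!: derivative_eq_intros)
    moreover have "((\<lambda>s. chart_velocity c {0..1} \<gamma> s) has_vector_derivative chart_acceleration c {0..1} \<gamma> (t * \<tau>))
        (at (t * \<tau>) within (\<lambda>\<tau>. t * \<tau>) ` {0..1})"
      using smooth_curve(2)[OF sm unit_interval_ne_bot tt[OF \<tau>] c']
      by (rule has_vector_derivative_within_subset) (use tt in auto)
    ultimately have "((\<lambda>\<tau>. chart_velocity c {0..1} \<gamma> (t * \<tau>)) has_vector_derivative
        t *\<^sub>R chart_acceleration c {0..1} \<gamma> (t * \<tau>)) (at \<tau> within {0..1})"
      using vector_diff_chain_within[of "\<lambda>\<tau>. t * \<tau>" t \<tau> "{0..1}" "\<lambda>s. chart_velocity c {0..1} \<gamma> s"] by (simp add: o_def)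
    then have "((\<lambda>\<tau>. t *\<^sub>R chart_velocity c {0..1} \<gamma> (t * \<tau>)) has_vector_derivative
        t *\<^sub>R t *\<^sub>R chart_acceleration c {0..1} \<gamma> (t * \<tau>)) (at \<tau> within S)"
      unfolding atS by (rule bounded_linear.has_vector_derivative[OF bounded_linear_scaleR_right])
    then have "((\<lambda>\<tau>. chart_velocity c {0..1} \<eta> \<tau>) has_vector_derivative
        t *\<^sub>R t *\<^sub>R chart_acceleration c {0..1} \<gamma> (t * \<tau>)) (at \<tau> within S)"
      by (rule has_vector_derivative_transform[rotated 2])
        (use \<tau> cA in \<open>auto simp: S_def charts_at_def intro!: d1\<close>)
    then show ?thesis
      unfolding atS using vector_derivative_within[OF unit_interval_ne_bot[OF \<tau>]] by (simp add: power2_eq_square)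
  qed
  have "geodesic A g {0..1} \<eta>"
    unfolding geodesic_def
  proof (intro conjI ballI sm\<eta>)
    fix \<tau> c assume \<tau>: "\<tau> \<in> {0..1}" and c: "c \<in> charts_at A (\<eta> \<tau>)"
    note cA = charts_atD[OF c]
    have c': "c \<in> charts_at A (\<gamma> (t * \<tau>))" using c by (simp add: \<eta>_def)
    interpret coordinate_metric "snd c ` fst c" "metric_coord A g c"
      by (rule coordinate_metric[OF cA(1)])
    define x where "x = snd c (\<eta> \<tau>)"
    define v1 where "v1 = chart_velocity c {0..1} \<gamma> (t * \<tau>)"
    define a where "a = chart_acceleration c {0..1} \<gamma> (t * \<tau>)"
    have x: "x \<in> snd c ` fst c" using cA by (simp add: x_def)
    \<comment> \<open>\<open>christoffel\<close> is a description, so its homogeneity is read off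
      from its products with all w; positivity then gives z = 0.\<close>
    define z where "z = t\<^sup>2 *\<^sub>R a + christoffel A g c x (t *\<^sub>R v1) (t *\<^sub>R v1)"
    have ga: "metric_coord A g c x a w = - \<Gamma>1 x v1 w" for w
      using geodesic_in_chart[OF geo tt[OF \<tau>] c'] by (simp add: x_def a_def v1_def \<eta>_def chart_\<Gamma>1_def)
    have "metric_coord A g c x z w = 0" for w
      unfolding z_def G_add1[OF x] metric_christoffel[OF cA(1) x]
      by (simp add: G_scale1[OF x] ga chart_\<Gamma>1_def \<Gamma>1_def DG_scale1[OF x] DG_scale2[OF x] DG_scale3[OF x]
          power2_eq_square algebra_simps)
    then have "z = 0" using pos[OF x, of z] by force
    then show "chart_acceleration c {0..1} \<eta> \<tau> + christoffel A g c (snd c (\<eta> \<tau>))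
        (chart_velocity c {0..1} \<eta> \<tau>) (chart_velocity c {0..1} \<eta> \<tau>) = 0"
      by (simp add: d1[OF \<tau> c] d2[OF \<tau> c] z_def x_def a_def v1_def)
  qed
  moreover have "velocity A {0..1} \<eta> 0 = tscale t v"
  proof
    fix c
    have "\<eta> 0 = \<gamma> 0" by (simp add: \<eta>_def)
    then show "velocity A {0..1} \<eta> 0 c = tscale t v c"
      using d1[of 0 c] by (auto simp: velocity_def tscale_def init(2)[symmetric])
  qed
  ultimately show ?thesis
    using init by (simp add: geodesic_from_def \<eta>_def)
qed

lemma exp_map_tscale:
  assumes "geodesic_from A g p v \<gamma>" "0 < t" "t \<le> 1"
  shows "exp_map A g p (tscale t v) = \<gamma> t"
  using exp_map_eq[OF geodesic_from_rescale[OF assms]] by simp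

text \<open>Scaling leaves the zero vector unchanged, so by \<open>exp_map_tscale\<close> the
  geodesic is constant for t > 0, and continuity at 0 identifies the value. This supplies the end t
  = 0 of every ray.\<close>

lemma exp_map_zero:
  assumes "geodesic_from A g p (\<lambda>c. 0) \<zeta>"
  shows "exp_map A g p (\<lambda>c. 0) = p"
proof -
  have z: "\<zeta> t = exp_map A g p (\<lambda>c. 0)" if "0 < t" "t \<le> 1" for t
    using exp_map_tscale[OF assms that] by (simp add: tscale_def)
  have 0: "\<zeta> 0 = p" and cont: "continuous_on {0..1} \<zeta>"
    using assms by (auto simp: geodesic_from_def geodesic_def smooth_into_def)
  have nb: "at 0 within {0<..1::real} \<noteq> bot"
    by (simp add: trivial_limit_within islimpt_Ioc)
  have 1: "(\<zeta> \<longlongrightarrow> \<zeta> 0) (at 0 within {0<..1})"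
    by (rule tendsto_within_subset[OF continuous_on_def[THEN iffD1, rule_format, OF cont]]) auto
  have "\<forall>\<^sub>F s in at 0 within {0<..1}. \<zeta> s = exp_map A g p (\<lambda>c. 0)"
    using z by (auto simp: eventually_at_filter)
  from tendsto_cong[OF this] 1 have "((\<lambda>_. exp_map A g p (\<lambda>c. 0)) \<longlongrightarrow> \<zeta> 0) (at (0::real) within {0<..1})" by blast
  then show ?thesis using tendsto_unique[OF nb tendsto_const] 0 by metis
qed

section \<open>Tangent norms and the injectivity radius\<close>

lemma tnorm_eq:
  assumes c: "c \<in> charts_at A p" and v: "v \<in> tangent_space A p"
  shows "tnorm g p v = sqrt (metric_coord A g c (snd c p) (v c) (v c))"
  using metric_of_coord[OF c, of "v c" "v c"] tangent_eq_of_coord[OF v c] by (simp add: tnorm_def)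

lemma tnorm_nonneg:
  assumes c: "c \<in> charts_at A p" and v: "v \<in> tangent_space A p"
  shows "0 \<le> tnorm g p v"
proof -
  note cA = charts_atD[OF c]
  interpret coordinate_metric "snd c ` fst c" "metric_coord A g c"
    by (rule coordinate_metric[OF cA(1)])
  have x: "snd c p \<in> snd c ` fst c" using cA by blast
  show ?thesis
    unfolding tnorm_eq[OF c v] using pos[OF x, of "v c"] linear_0[OF lin2[OF x]]
    by (cases "v c = 0") auto
qed

lemma open_carrier: "open (carrier A)"
  unfolding carrier_def using chart(1) by blast

text \<open>The supremum provides, for each of the two vectors, a ball around 0 on which the
  exponential map is injective. Such balls are nested, so one of them contains both vectors.\<close>

lemma exp_injective_below_injectivity_radius:
  assumes "v \<in> tangent_space A p" "ereal (tnorm g p v) < injectivity_radius A g p"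
    and "w \<in> tangent_space A p" "ereal (tnorm g p w) < injectivity_radius A g p"
    and "exp_map A g p v = exp_map A g p w"
  shows "v = w"
proof -
  have "\<exists>r. exp_diffeo_on A g p (tball A g p r) \<and> u \<in> tball A g p r"
    if "u \<in> tangent_space A p" "ereal (tnorm g p u) < injectivity_radius A g p" for u
    using that unfolding injectivity_radius_def less_Sup_iff tball_def by auto
  with assms(1-4) obtain r s where "exp_diffeo_on A g p (tball A g p r)" "v \<in> tball A g p r"
    "exp_diffeo_on A g p (tball A g p s)" "w \<in> tball A g p s" by metis
  moreover have "tball A g p r \<subseteq> tball A g p s \<or> tball A g p s \<subseteq> tball A g p r"
    by (cases "r \<le> s") (auto simp: tball_def)
  ultimately have "\<exists>B. inj_on (exp_map A g p) B \<and> v \<in> B \<and> w \<in> B"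
    unfolding exp_diffeo_on_def by blast
  then show ?thesis using assms(5) by (auto dest: inj_onD)
qed

section \<open>The equivalence for positive injectivity radius\<close>

lemma normal_iff_spherical_if_injectivity_radius_pos:
  assumes c: "c \<in> charts_at A p" and R: "0 < injectivity_radius A g p"
  shows "\<exists>W. open W \<and> p \<in> W \<and> W \<subseteq> carrier A \<and>
    (\<forall>I \<alpha>. regular_curve A I \<alpha> \<and> \<alpha> ` I \<subseteq> W - {p} \<longrightarrow>
       (normal_curve A g p I \<alpha> \<longleftrightarrow> lies_on_geodesic_sphere A g p I \<alpha>))"
proof -
  note cA = charts_atD[OF c]
  let ?V = "snd c ` fst c"
  define G where "G = metric_coord A g c"
  define x0 where "x0 = snd c p"
  interpret coordinate_metric ?V G
    unfolding G_def by (rule coordinate_metric[OF cA(1)])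
  have x0V: "x0 \<in> ?V" using cA by (simp add: x0_def)
  define E where "E = of_coord A p c"
  have E_T: "E u \<in> tangent_space A p" for u
    unfolding E_def by (rule of_coord_in_tangent_space[OF c])
  have E_c: "E u c = u" for u unfolding E_def by (rule of_coord_self[OF c])
  have E_eq: "E (v c) = v" if "v \<in> tangent_space A p" for v
    unfolding E_def using tangent_eq_of_coord[OF that c] by simp
  have E_scale: "E (t *\<^sub>R u) = tscale t (E u)" for t u
    unfolding E_def by (rule of_coord_scale[OF c])
  have norm_E: "tnorm g p (E u) = sqrt (G x0 u u)" for u
    using tnorm_eq[OF c E_T] by (simp add: E_c G_def x0_def)
  have G_nonneg: "0 \<le> G x0 u u" for u
    using pos[OF x0V, of u] linear_0[OF lin2[OF x0V]] by (cases "u = 0") auto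
  obtain r0 where r0: "0 < r0" "exp_diffeo_on A g p (tball A g p r0)"
    using R unfolding injectivity_radius_def less_Sup_iff by auto
  have r0R: "ereal r0 \<le> injectivity_radius A g p"
    unfolding injectivity_radius_def using r0 by (intro Sup_upper) auto
  define B where "B = tball A g p r0"
  define e where "e = exp_map A g p"
  define F where "F = (\<lambda>u. e (E u))"
  define h where "h = (\<lambda>q. the_inv_into B e q c)"
  \<comment> \<open>\<open>E\<close> and evaluation at \<open>c\<close> identify the tangent space
    with the model space; \<open>U0\<close> is the ball \<open>B\<close> in these coordinates, the
    interior of an ellipsoid.\<close>
  define U0 where "U0 = (\<lambda>v. v c) ` B"
  have U0_iff: "u \<in> U0 \<longleftrightarrow> sqrt (G x0 u u) < r0" for u
  proof
    assume "u \<in> U0"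
    then obtain v where v: "v \<in> B" "u = v c" by (auto simp: U0_def)
    then show "sqrt (G x0 u u) < r0"
      using norm_E[of u] E_eq[of v] by (auto simp: B_def tball_def)
  next
    assume "sqrt (G x0 u u) < r0"
    then have "E u \<in> B" using E_T norm_E by (simp add: B_def tball_def)
    then show "u \<in> U0" unfolding U0_def by (intro image_eqI[of _ _ "E u"]) (simp_all add: E_c)
  qed
  have EB: "E u \<in> B" if "u \<in> U0" for u
    using that E_T norm_E by (simp add: U0_iff B_def tball_def)
  have dif: "B \<subseteq> exp_domain A g p" "inj_on e B" "open (e ` B)"
    "smooth_into A U0 F" "smooth_from A (e ` B) h"
    using r0(2) c unfolding exp_diffeo_on_def B_def[symmetric] e_def[symmetric] U0_def F_def E_def h_def
    by (auto simp: o_def)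
  have hF: "h (F u) = u" if "u \<in> U0" for u
    unfolding h_def F_def using the_inv_into_f_f[OF dif(2) EB[OF that]] E_c by simp
  have open_U0: "open U0"
  proof -
    have "continuous_on UNIV (\<lambda>u. G x0 u u)"
    proof (rule has_derivative_continuous_on)
      show "((\<lambda>u. G x0 u u) has_derivative (\<lambda>h. DG x0 0 u u + G x0 h u + G x0 u h)) (at u within UNIV)" for u
        using has_derivative_G[OF has_derivative_const has_derivative_ident has_derivative_ident UNIV_I x0V] .
    qed
    then have "open {u. sqrt (G x0 u u) < r0}"
      by (intro open_Collect_less continuous_intros)
    moreover have "U0 = {u. sqrt (G x0 u u) < r0}" by (rule set_eqI) (simp add: U0_iff)
    ultimately show ?thesis by simp
  qed
  have U00: "0 \<in> U0" using r0 linear_0[OF lin2[OF x0V]] by (simp add: U0_iff)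
  have contF: "continuous_on U0 F" using dif(4) by (simp add: smooth_into_def)
  have F0: "F 0 = p"
  proof -
    have "E 0 = (\<lambda>c. 0)" using E_scale[of 0 0] by (simp add: tscale_def)
    moreover have "E 0 \<in> exp_domain A g p" using EB[OF U00] dif(1) by blast
    ultimately show ?thesis
      using exp_map_zero unfolding exp_domain_def F_def e_def by auto
  qed
  define U1 where "U1 = U0 \<inter> F -` fst c"
  have open_U1: "open U1"
    unfolding U1_def by (rule continuous_open_preimage[OF contF open_U0 chart(1)[OF cA(1)]])
  have "0 \<in> U1" using U00 F0 cA by (simp add: U1_def)
  then obtain \<epsilon> where \<epsilon>: "0 < \<epsilon>" "ball 0 \<epsilon> \<subseteq> U1"
    using open_U1 open_contains_ball by blast
  \<comment> \<open>A Euclidean ball in the coordinates is star-shaped about 0, so the ray of each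
    of its vectors stays in \<open>U\<close>, and the geodesic of that vector in the chart.\<close>
  define U where "U = ball (0::'e) \<epsilon>"
  have U: "open U" "U \<subseteq> U1" "U \<subseteq> U0" "0 \<in> U" "\<And>u. u \<in> U \<Longrightarrow> F u \<in> fst c"
    using \<epsilon> by (auto simp: U_def U1_def)
  have star: "t *\<^sub>R w \<in> U" if "w \<in> U" "t \<in> {0..1}" for w and t :: real
  proof -
    have "\<bar>t\<bar> * norm w \<le> 1 * norm w" using that by (intro mult_right_mono) auto
    then show ?thesis using that by (auto simp: U_def)
  qed
  define \<Phi> where "\<Phi> = snd c \<circ> F"
  have "smooth_on U1 \<Phi>"
    using dif(4) cA unfolding smooth_into_def U1_def \<Phi>_def by blast
  then have \<Phi>C2: "Ck_on (Suc (Suc 0)) \<Phi> U"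
    using Ck_on_open_subset[OF open_U1 U(1,2)] unfolding smooth_on_def by blast
  define D where "D = (\<lambda>x v. frechet_derivative \<Phi> (at x) v)"
  have d1: "(\<Phi> has_derivative D x) (at x)" if "x \<in> U" for x
    using Ck_on_open_Suc(1)[OF U(1) \<Phi>C2 that] by (simp add: D_def)
  have d2: "((\<lambda>x. D x v) has_derivative frechet_derivative (\<lambda>x. D x v) (at x)) (at x)" if "x \<in> U" for x v
    using Ck_on_open_Suc(1)[OF U(1) Ck_on_open_Suc(2)[OF U(1) \<Phi>C2] that] by (simp add: D_def)
  have ray: "((\<lambda>t. t *\<^sub>R w) has_vector_derivative w) (at t within S)" for w :: 'e and t S
    by (auto intro!: derivative_eq_intros)
  \<comment> \<open>The points F(t w), each defined by a geodesic of its own, lie on the single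
    geodesic of \<open>E w\<close>; t = 0 is covered by \<open>F0\<close>.\<close>
  have "\<exists>\<gamma>. geodesic_from A g p (E w) \<gamma> \<and> (\<forall>t\<in>{0..1}. F (t *\<^sub>R w) = \<gamma> t)" if w: "w \<in> U" for w
  proof -
    obtain \<gamma> where \<gamma>: "geodesic_from A g p (E w) \<gamma>"
      using EB dif(1) w U(3) unfolding exp_domain_def by blast
    have "F (t *\<^sub>R w) = \<gamma> t" if "t \<in> {0..1}" for t
    proof (cases "t = 0")
      case True
      then show ?thesis using F0 \<gamma> by (simp add: geodesic_from_def)
    next
      case False
      then show ?thesis using exp_map_tscale[OF \<gamma>, of t] that by (simp add: F_def e_def E_scale)
    qed
    with \<gamma> show ?thesis by blast
  qed
  then obtain \<gamma> where \<gamma>: "\<And>w. w \<in> U \<Longrightarrow> geodesic_from A g p (E w) (\<gamma> w)"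
    "\<And>w t. w \<in> U \<Longrightarrow> t \<in> {0..1} \<Longrightarrow> F (t *\<^sub>R w) = \<gamma> w t"
    by metis
  have c\<gamma>: "c \<in> charts_at A (\<gamma> w t)" if "w \<in> U" "t \<in> {0..1}" for w t
    using \<gamma>(2)[OF that] U(5)[OF star[OF that]] cA(1) by (simp add: charts_at_def)
  have vel: "chart_velocity c {0..1} (\<gamma> w) t = D (t *\<^sub>R w) w" if w: "w \<in> U" and t: "t \<in> {0..1}" for w t
  proof (rule vector_derivative_within[OF unit_interval_ne_bot[OF t]])
    show "((snd c \<circ> \<gamma> w) has_vector_derivative D (t *\<^sub>R w) w) (at t within {0..1})"
      by (rule has_vector_derivative_transform[OF t _ has_vector_derivative_chain[OF d1[OF star[OF w t]] ray]])
        (simp add: \<Phi>_def \<gamma>(2)[OF w])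
  qed
  have acc: "chart_acceleration c {0..1} (\<gamma> w) t = frechet_derivative (\<lambda>x. D x w) (at (t *\<^sub>R w)) w"
    if w: "w \<in> U" and t: "t \<in> {0..1}" for w t
  proof (rule vector_derivative_within[OF unit_interval_ne_bot[OF t]])
    show "((\<lambda>t. chart_velocity c {0..1} (\<gamma> w) t) has_vector_derivative
        frechet_derivative (\<lambda>x. D x w) (at (t *\<^sub>R w)) w) (at t within {0..1})"
      by (rule has_vector_derivative_transform[OF t _ has_vector_derivative_chain[OF d2[OF star[OF w t]] ray]]) (rule vel[OF w])
  qed
  have \<Phi>0: "\<Phi> 0 = x0" by (simp add: \<Phi>_def F0 x0_def)
  have gauss: "G (\<Phi> w) (D w u) (D w w) = G x0 u w" if w: "w \<in> U" for w u
    unfolding \<Phi>0[symmetric] D_def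
  proof (rule gauss_lemma[OF U(1) star \<Phi>C2 _ _ _ w])
    show "\<Phi> w \<in> ?V" if "w \<in> U" for w using U(5)[OF that] by (simp add: \<Phi>_def)
    \<comment> \<open>The derivative of the exponential map at 0 is the identity: the geodesic
      \<gamma> w has initial velocity \<open>E w\<close>, with coordinates w.\<close>
    show "frechet_derivative \<Phi> (at 0) w = w" if w: "w \<in> U" for w
    proof -
      have "velocity A {0..1} (\<gamma> w) 0 c = E w c"
        using \<gamma>(1)[OF w] by (simp add: geodesic_from_def)
      then show ?thesis using vel[OF w, of 0] c\<gamma>[OF w, of 0] by (simp add: velocity_def E_c D_def)
    qed
    show "G (\<Phi> (t *\<^sub>R w)) (frechet_derivative (\<lambda>x. frechet_derivative \<Phi> (at x) w) (at (t *\<^sub>R w)) w) z =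
        - \<Gamma>1 (\<Phi> (t *\<^sub>R w)) (frechet_derivative \<Phi> (at (t *\<^sub>R w)) w) z"
      if w: "w \<in> U" and t: "t \<in> {0..1}" for w t z
    proof -
      have "geodesic A g {0..1} (\<gamma> w)" using \<gamma>(1)[OF w] by (simp add: geodesic_from_def)
      from geodesic_in_chart[OF this t c\<gamma>[OF w t], of z] show ?thesis
        unfolding vel[OF w t] acc[OF w t] \<gamma>(2)[OF w t, symmetric]
        by (simp add: chart_\<Gamma>1_def G_def \<Phi>_def D_def)
    qed
  qed
  define W where "W = F ` U"
  \<comment> \<open>The inverse of \<Phi>; its smoothness on \<open>Q\<close> is part of
    \<open>exp_diffeo_on\<close>.\<close>
  define \<Psi> where "\<Psi> = h \<circ> chart_inv c"
  define Q where "Q = snd c ` (fst c \<inter> e ` B)"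
  have open_Q: "open Q" unfolding Q_def by (rule open_chart_image[OF cA(1) dif(3)])
  have smooth_\<Psi>: "smooth_on Q \<Psi>"
    using dif(5) cA unfolding smooth_from_def Q_def \<Psi>_def by (simp add: Int_commute)
  have inQ: "snd c (F u) \<in> Q" if "u \<in> U" for u
    using U(3,5) EB that unfolding Q_def F_def by blast
  have \<Psi>F: "\<Psi> (snd c (F u)) = u" if "u \<in> U" for u
    using U(3,5) hF that chart(6)[OF cA(1)] by (auto simp: \<Psi>_def)
  \<comment> \<open>This rewrites the image \<open>W\<close> as a preimage under the continuous
    inverse \<Psi>, from which openness can be read off.\<close>
  have W_eq: "W = fst c \<inter> snd c -` (Q \<inter> \<Psi> -` U)"
  proof
    show "W \<subseteq> fst c \<inter> snd c -` (Q \<inter> \<Psi> -` U)"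
      using U(5) inQ \<Psi>F by (auto simp: W_def)
    show "fst c \<inter> snd c -` (Q \<inter> \<Psi> -` U) \<subseteq> W"
    proof
      fix q assume q: "q \<in> fst c \<inter> snd c -` (Q \<inter> \<Psi> -` U)"
      then obtain q' where q': "q' \<in> fst c" "q' \<in> e ` B" "snd c q = snd c q'"
        by (auto simp: Q_def)
      then have "q = q'" using q chart(6)[OF cA(1)] by (metis IntD1)
      then obtain v where v: "v \<in> B" "q = e v" using q' by blast
      have "v \<in> tangent_space A p" using v by (simp add: B_def tball_def)
      then have "q = F (v c)" using v E_eq by (simp add: F_def)
      moreover have "\<Psi> (snd c q) = v c"
        using q chart(6)[OF cA(1)] the_inv_into_f_f[OF dif(2) v(1)] v(2) by (simp add: \<Psi>_def h_def)
      ultimately show "q \<in> W" using q by (auto simp: W_def)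
    qed
  qed
  have open_W: "open W"
    unfolding W_eq
    by (intro continuous_open_preimage[OF chart(4)[OF cA(1)] chart(1)[OF cA(1)]]
        continuous_open_preimage[OF smooth_on_open(2)[OF open_Q smooth_\<Psi>]] open_Q U(1))
  have pW: "p \<in> W" using U(4) F0 unfolding W_def by force
  have Wc: "W \<subseteq> fst c" using W_eq by blast
  have main: "normal_curve A g p I \<alpha> \<longleftrightarrow> lies_on_geodesic_sphere A g p I \<alpha>"
    if reg: "regular_curve A I \<alpha>" and \<alpha>W: "\<alpha> ` I \<subseteq> W - {p}" for I \<alpha>
  proof -
    have I: "is_interval I" "interior I \<noteq> {}" and sm: "smooth_into A I \<alpha>"
      using reg by (auto simp: regular_curve_def)
    obtain s0 where s0: "s0 \<in> I" using I(2) interior_subset by blast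
    note nb = at_within_interval_ne_bot[OF I]
    have c\<alpha>: "c \<in> charts_at A (\<alpha> s)" if "s \<in> I" for s
      using that \<alpha>W Wc cA(1) by (auto simp: charts_at_def)
    \<comment> \<open>The lift of \<alpha> through the exponential map, in coordinates.\<close>
    define w where "w = (\<lambda>s. \<Psi> (snd c (\<alpha> s)))"
    have w: "w s \<in> U" "F (w s) = \<alpha> s" if "s \<in> I" for s
    proof -
      have "\<alpha> s \<in> W" using that \<alpha>W by blast
      then obtain u where "u \<in> U" "\<alpha> s = F u" by (auto simp: W_def)
      then show "w s \<in> U" "F (w s) = \<alpha> s" using \<Psi>F by (auto simp: w_def)
    qed
    have w0: "w s \<noteq> 0" if "s \<in> I" for s using w(2)[OF that] F0 \<alpha>W that by auto
    define a' where "a' = (\<lambda>s. chart_velocity c I \<alpha> s)"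
    have a: "((snd c \<circ> \<alpha>) has_vector_derivative a' s) (at s within I)" if "s \<in> I" for s
      unfolding a'_def by (rule smooth_curve(1)[OF sm nb that c\<alpha>[OF that]])
    define w' where "w' = (\<lambda>s. frechet_derivative \<Psi> (at (snd c (\<alpha> s))) (a' s))"
    have wd: "(w has_vector_derivative w' s) (at s within I)" if s: "s \<in> I" for s
    proof -
      have "snd c (\<alpha> s) \<in> Q" using inQ[OF w(1)[OF s]] w(2)[OF s] by simp
      then have "(\<Psi> has_derivative frechet_derivative \<Psi> (at (snd c (\<alpha> s)))) (at ((snd c \<circ> \<alpha>) s))"
        using smooth_on_open(1)[OF open_Q smooth_\<Psi>] by simp
      from has_vector_derivative_chain[OF this a[OF s]] show ?thesis by (simp add: w_def w'_def)
    qed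
    \<comment> \<open>Both sides are the derivative of \<alpha> = F o w in the chart, and
      derivatives within \<open>I\<close> are unique.\<close>
    have a'_eq: "a' s = D (w s) (w' s)" if s: "s \<in> I" for s
    proof (rule vector_derivative_unique_within[OF nb[OF s] a[OF s]])
      show "((snd c \<circ> \<alpha>) has_vector_derivative D (w s) (w' s)) (at s within I)"
        by (rule has_vector_derivative_transform[OF s _ has_vector_derivative_chain[OF d1[OF w(1)[OF s]] wd[OF s]]])
          (simp add: \<Phi>_def w(2))
    qed
    \<comment> \<open>The radial geodesic is identified with \<gamma> (w s) on [0, 1] only; this
      suffices, as its velocity at 1 is taken within [0, 1]. The product is then
      \<open>gauss\<close> at \<open>w s\<close> with u = w' s.\<close>
    have product: "g (\<alpha> s) (velocity A I \<alpha> s) (velocity A {0..1} (radial_geodesic A g p (E (w s))) 1) =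
        G x0 (w' s) (w s)" if s: "s \<in> I" for s
    proof -
      have rad: "radial_geodesic A g p (E (w s)) t = \<gamma> (w s) t" if "t \<in> {0..1}" for t
        using \<gamma>(2)[OF w(1)[OF s] that] by (simp add: radial_geodesic_def F_def e_def E_scale)
      have \<gamma>1: "\<gamma> (w s) 1 = \<alpha> s" using \<gamma>(2)[OF w(1)[OF s], of 1] w(2)[OF s] by simp
      have sm\<gamma>: "smooth_into A {0..1} (\<gamma> (w s))"
        using \<gamma>(1)[OF w(1)[OF s]] by (simp add: geodesic_from_def geodesic_def)
      have "velocity A {0..1} (radial_geodesic A g p (E (w s))) 1 = velocity A {0..1} (\<gamma> (w s)) 1"
      proof
        fix d
        have "chart_velocity d {0..1} (radial_geodesic A g p (E (w s))) 1 = chart_velocity d {0..1} (\<gamma> (w s)) 1"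
          by (rule vector_derivative_cong_on) (simp_all add: rad)
        then show "velocity A {0..1} (radial_geodesic A g p (E (w s))) 1 d = velocity A {0..1} (\<gamma> (w s)) 1 d"
          using rad[of 1] by (simp add: velocity_def)
      qed
      also have "\<dots> = of_coord A (\<alpha> s) c (D (w s) (w s))"
        using velocity_eq_of_coord[OF sm\<gamma> unit_interval_ne_bot _ c\<gamma>[OF w(1)[OF s]], of 1] vel[OF w(1)[OF s], of 1]
        by (simp add: \<gamma>1)
      finally have "g (\<alpha> s) (velocity A I \<alpha> s) (velocity A {0..1} (radial_geodesic A g p (E (w s))) 1) =
          G (snd c (\<alpha> s)) (a' s) (D (w s) (w s))"
        using velocity_eq_of_coord[OF sm nb s c\<alpha>[OF s]] metric_of_coord[OF c\<alpha>[OF s]]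
        by (simp add: a'_def G_def)
      also have "\<dots> = G x0 (w' s) (w s)"
        using gauss[OF w(1)[OF s], of "w' s"] w(2)[OF s] a'_eq[OF s] by (simp add: \<Phi>_def)
      finally show ?thesis .
    qed
    have ER: "ereal (tnorm g p (E (w s))) < injectivity_radius A g p" if "s \<in> I" for s
      using w(1)[OF that] U(3) U0_iff norm_E r0R by (metis ereal_less_eq(3) less_le_trans less_ereal.simps(1) subsetD)
    \<comment> \<open>Normal curves and geodesic spheres admit all vectors below the injectivity
      radius, possibly longer than those in \<open>B\<close>. Injectivity up to that radius leaves
      only the lift.\<close>
    have v_unique: "v = E (w s)"
      if "s \<in> I" "v \<in> tangent_space A p" "ereal (tnorm g p v) < injectivity_radius A g p" "exp_map A g p v = \<alpha> s" for s v
      using exp_injective_below_injectivity_radius[OF that(2,3) E_T ER[OF that(1)]] w(2)[OF that(1)] that(4)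
      by (simp add: F_def e_def)
    define f where "f = (\<lambda>s. G x0 (w s) (w s))"
    have fd: "(f has_real_derivative 2 * G x0 (w' s) (w s)) (at s within I)" if s: "s \<in> I" for s
      unfolding f_def
      by (rule DERIV_cong[OF has_vector_derivative_G[OF has_vector_derivative_const wd[OF s] wd[OF s] s x0V]])
        (simp add: linear_0[OF lin_DG1[OF x0V]] sym[OF x0V, of "w s"])
    have normal: "normal_curve A g p I \<alpha> \<longleftrightarrow> (\<forall>s\<in>I. G x0 (w' s) (w s) = 0)"
    proof
      assume n: "normal_curve A g p I \<alpha>"
      show "\<forall>s\<in>I. G x0 (w' s) (w s) = 0"
      proof
        fix s assume s: "s \<in> I"
        then obtain v where "v \<in> tangent_space A p" "ereal (tnorm g p v) < injectivity_radius A g p"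
          "exp_map A g p v = \<alpha> s"
          "g (\<alpha> s) (velocity A I \<alpha> s) (velocity A {0..1} (radial_geodesic A g p v) 1) = 0"
          using n unfolding normal_curve_def by blast
        with v_unique[OF s] product[OF s] show "G x0 (w' s) (w s) = 0" by metis
      qed
    next
      assume "\<forall>s\<in>I. G x0 (w' s) (w s) = 0"
      then show "normal_curve A g p I \<alpha>"
        unfolding normal_curve_def using reg E_T ER w(2) product unfolding F_def e_def by metis
    qed
    show ?thesis
      unfolding normal
    proof
      assume "\<forall>s\<in>I. G x0 (w' s) (w s) = 0"
      then have "(f has_real_derivative 0) (at s within I)" if "s \<in> I" for s
        using fd[OF that] that by simp
      from has_field_derivative_zero_constant[OF _ this] obtain C where C: "\<And>s. s \<in> I \<Longrightarrow> f s = C"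
        using I(1) is_interval_convex by blast
      have n: "tnorm g p (E (w s)) = sqrt C" if "s \<in> I" for s
        using C[OF that] norm_E by (simp add: f_def)
      show "lies_on_geodesic_sphere A g p I \<alpha>"
        unfolding lies_on_geodesic_sphere_def geodesic_sphere_def
      \<comment> \<open>\<open>f\<close> is the squared norm of the lift, hence the root. It is
        positive because the curve avoids p.\<close>
      proof (intro exI[of _ "sqrt C"] conjI subsetI)
        show "0 < sqrt C" using C[OF s0] pos[OF x0V w0[OF s0]] by (simp add: f_def)
        show "ereal (sqrt C) < injectivity_radius A g p" using ER[OF s0] n[OF s0] by simp
        fix q assume "q \<in> \<alpha> ` I"
        then obtain s where s: "s \<in> I" "q = \<alpha> s" by blast
        then show "q \<in> exp_map A g p ` {v \<in> tangent_space A p. tnorm g p v = sqrt C}"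
          using w(2)[OF s(1)] n[OF s(1)] E_T by (auto simp: F_def e_def intro!: image_eqI[of _ _ "E (w s)"])
      qed
    next
      assume "lies_on_geodesic_sphere A g p I \<alpha>"
      then obtain \<delta> where \<delta>: "ereal \<delta> < injectivity_radius A g p"
        "\<alpha> ` I \<subseteq> exp_map A g p ` {v \<in> tangent_space A p. tnorm g p v = \<delta>}"
        unfolding lies_on_geodesic_sphere_def geodesic_sphere_def by blast
      have f_const: "f s = \<delta>\<^sup>2" if s: "s \<in> I" for s
      proof -
        obtain v where "v \<in> tangent_space A p" "tnorm g p v = \<delta>" "exp_map A g p v = \<alpha> s"
          using \<delta>(2) s by force
        with v_unique[OF s] \<delta>(1) have "sqrt (f s) = \<delta>" using norm_E by (metis f_def)
        then show ?thesis using G_nonneg by (auto simp: f_def)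
      qed
      \<comment> \<open>On a sphere \<open>f\<close> is constant, and derivatives within
        \<open>I\<close> are unique, so the product vanishes at end points of \<open>I\<close> as
        well.\<close>
      show "\<forall>s\<in>I. G x0 (w' s) (w s) = 0"
      proof
        fix s assume s: "s \<in> I"
        have "(f has_vector_derivative 2 * G x0 (w' s) (w s)) (at s within I)"
          using fd[OF s] by (simp add: has_real_derivative_iff_has_vector_derivative)
        moreover have "(f has_vector_derivative 0) (at s within I)"
          by (rule has_vector_derivative_transform[OF s f_const has_vector_derivative_const])
        ultimately have "2 * G x0 (w' s) (w s) = 0"
          by (rule vector_derivative_unique_within[OF nb[OF s]])
        then show "G x0 (w' s) (w s) = 0" by simp
      qed
    qed
  qed
  show ?thesis
  proof (intro exI[of _ W] conjI allI impI)
    show "W \<subseteq> carrier A" using Wc cA(1) by (auto simp: carrier_def)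
  qed (use open_W pW main in blast)+
qed

end

theorem proposition6p1p1:
  fixes A :: "('a::{second_countable_topology, t2_space}, 'e::euclidean_space) chart set"
    and g :: "('a, 'e) metric_tensor"
    and p :: 'a
  assumes "riemannian_manifold A g"
    and "p \<in> carrier A"
  shows "\<exists>W. open W \<and> p \<in> W \<and> W \<subseteq> carrier A \<and>
    (\<forall>I \<alpha>. regular_curve A I \<alpha> \<and> \<alpha> ` I \<subseteq> W - {p} \<longrightarrow>
       (normal_curve A g p I \<alpha> \<longleftrightarrow> lies_on_geodesic_sphere A g p I \<alpha>))"
proof -
  interpret riemannian A g by (rule riemannian.intro[OF assms(1)])
  obtain c where c: "c \<in> charts_at A p" using assms(2) carrier_charts_at by blast
  show ?thesis
  proof (cases "0 < injectivity_radius A g p")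
    case True
    then show ?thesis by (rule normal_iff_spherical_if_injectivity_radius_pos[OF c])
  next
    case False
    have "\<not> normal_curve A g p I \<alpha>" if reg: "regular_curve A I \<alpha>" for I \<alpha>
    proof
      assume n: "normal_curve A g p I \<alpha>"
      \<comment> \<open>The condition in \<open>normal_curve\<close> is universal over
        \<open>I\<close>, so a point of \<open>I\<close> is needed to obtain a vector whose norm is
        below the radius.\<close>
      obtain s where "s \<in> I"
        using reg interior_subset unfolding regular_curve_def by blast
      with n obtain v where v: "v \<in> tangent_space A p" "ereal (tnorm g p v) < injectivity_radius A g p"
        unfolding normal_curve_def by blast
      have "0 \<le> ereal (tnorm g p v)" using tnorm_nonneg[OF c v(1)] by simp
      with v(2) False show False by (meson le_less_trans)
    qed
    moreover have "\<not> lies_on_geodesic_sphere A g p I \<alpha>" for I \<alpha>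
    proof
      assume "lies_on_geodesic_sphere A g p I \<alpha>"
      then obtain \<delta> where "0 < ereal \<delta>" "ereal \<delta> < injectivity_radius A g p"
        unfolding lies_on_geodesic_sphere_def by auto
      with False show False by (meson less_trans)
    qed
    ultimately show ?thesis
      using open_carrier assms(2) by (intro exI[of _ "carrier A"]) blast
  qed
qed

end
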